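(* Let $p=ef+1$ be an odd prime, where $e,f$ are positive integers and $f$ is even, and assume $2^{p-1}\not\equiv 1 \pmod{p^2}$. Let $n\ge 1$, let $g$ be an odd primitive root modulo $p^n$, and let $b$ be an integer with $0\le b<p^{n-1}f$. Let $\mathrm{ord}_p(2)$ be the multiplicative order of $2$ modulo $p$ and $v=\gcd\big(\frac{p-1}{\mathrm{ord}_p(2)},f\big)$. Let $s^\infty$ and $\tilde s^\infty$ be the binary sequences of period $2p^n$ defined in the context. (i) There is an integer $r$ with $0\le r\le \frac{p-1}{\mathrm{ord}_p(2)}$ such that the linear complexity satisfies $L(s^\infty)=2p^n-r\cdot\mathrm{ord}_p(2)$. Furthermore, $L(s^\infty)=2p^n-p+1$ if $v=f/2$, and $L(s^\infty)=2p^n$ if $v=1$, or $2v\mid \frac f2$, or $f=v$. (ii) There is an integer $r$ with $0\le r\le \frac{p-1}{\mathrm{ord}_p(2)}$ such that $2p^n-2r\cdot\mathrm{ord}_p(2)\le L(\tilde s^\infty)\le 2p^n-r\cdot \mathrm{ord}_p(2)$. Furthermore, $L(\tilde s^\infty)=2p^n-3(p-1)/2$ if $v=f$, and $L(\tilde s^\infty)=2p^n$ if $v\mid\frac f2$, or ($v=2$ and $v\neq f$).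
   Context: For $1\le j\le n$ let $d_j=p^{j-1}f$. Define $D^{(2p^j)}_0=\{g^{t d_j} \bmod 2p^j : 0\le t<e\}$ and $D^{(2p^j)}_i=\{g^i x \bmod 2p^j : x\in D^{(2p^j)}_0\}$ for $0\le i<d_j$; subscripts of these classes are always taken modulo $d_j$. For $A\subseteq \mathbb{Z}_{2p^j}$ write $2A=\{2x \bmod 2p^j: x\in A\}$ and $p^{n-j}A=\{p^{n-j}x \bmod 2p^n : x\in A\}\subseteq\mathbb{Z}_{2p^n}$. Define $\mathcal{C}_1=\bigcup_{j=1}^{n}\bigcup_{i=0}^{d_j/2-1} p^{n-j}\big(D^{(2p^j)}_{i+b}\cup 2D^{(2p^j)}_{i+b}\big)\cup\{0\}$ and $\mathcal{C}_0=\bigcup_{j=1}^{n}\bigcup_{i=d_j/2}^{d_j-1} p^{n-j}\big(D^{(2p^j)}_{i+b}\cup 2D^{(2p^j)}_{i+b}\big)\cup\{p^n\}$, $\widetilde{\mathcal{C}}_1=\bigcup_{j=1}^{n}p^{n-j}\Big(\bigcup_{i=0}^{d_j/2-1} D^{(2p^j)}_{i+b}\cup\bigcup_{i=d_j/2}^{d_j-1}2D^{(2p^j)}_{i+b}\Big)\cup\{0\}$ and $\widetilde{\mathcal{C}}_0=\bigcup_{j=1}^{n}p^{n-j}\Big(\bigcup_{i=0}^{d_j/2-1} 2D^{(2p^j)}_{i+b}\cup\bigcup_{i=d_j/2}^{d_j-1}D^{(2p^j)}_{i+b}\Big)\cup\{p^n\}$; these give partitions $\mathbb{Z}_{2p^n}=\mathcal{C}_0\cup\mathcal{C}_1=\widetilde{\mathcal{C}}_0\cup\widetilde{\mathcal{C}}_1$.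 The binary sequence $s^\infty=(s_0,s_1,\dots)$ is given by $s_i=0$ if $i \bmod 2p^n\in\mathcal{C}_0$ and $s_i=1$ if $i\bmod 2p^n\in\mathcal{C}_1$; similarly $\tilde s_i=0$ if $i\bmod 2p^n\in\widetilde{\mathcal{C}}_0$ and $\tilde s_i=1$ if $i\bmod 2p^n\in\widetilde{\mathcal{C}}_1$. Linear complexity is over $\mathbb{F}_2$: for a binary sequence of period $N$ with $S(x)=\sum_{i=0}^{N-1}s_ix^i$, $L=N-\deg\gcd(x^N-1,S(x))$.
   Formalization: In (i), the claim L(s)=2p^n for v=1, 2v | f/2 or f=v is made only when v≠f/2; this excludes just f=2, v=1, where the statement as given also asserts the contradictory value 2p^n-p+1 (e.g. p=3), which is the one proved there. *)

theory Defs
  imports "HOL-Number_Theory.Number_Theory" "HOL-Computational_Algebra.Polynomial_Factorial"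
          "Berlekamp_Zassenhaus.Finite_Field"
begin

definition dj :: "nat \<Rightarrow> nat \<Rightarrow> nat \<Rightarrow> nat" where
  "dj p f j = p ^ (j - 1) * f"

definition cls0 :: "nat \<Rightarrow> nat \<Rightarrow> nat \<Rightarrow> nat \<Rightarrow> nat \<Rightarrow> nat set" where
  "cls0 p e f g j = (\<lambda>t. g ^ (t * dj p f j) mod (2 * p ^ j)) ` {0..<e}"

definition cls :: "nat \<Rightarrow> nat \<Rightarrow> nat \<Rightarrow> nat \<Rightarrow> nat \<Rightarrow> nat \<Rightarrow> nat set" where
  "cls p e f g j i = (\<lambda>x. g ^ i * x mod (2 * p ^ j)) ` cls0 p e f g j"

definition dbl :: "nat \<Rightarrow> nat set \<Rightarrow> nat set" where
  "dbl m A = (\<lambda>x. 2 * x mod m) ` A"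

definition scl :: "nat \<Rightarrow> nat \<Rightarrow> nat \<Rightarrow> nat set \<Rightarrow> nat set" where
  "scl p n j A = (\<lambda>x. p ^ (n - j) * x mod (2 * p ^ n)) ` A"

definition clsb :: "nat \<Rightarrow> nat \<Rightarrow> nat \<Rightarrow> nat \<Rightarrow> nat \<Rightarrow> nat \<Rightarrow> nat \<Rightarrow> nat set" where
  "clsb p e f g b j i = cls p e f g j ((i + b) mod dj p f j)"

definition C1 :: "nat \<Rightarrow> nat \<Rightarrow> nat \<Rightarrow> nat \<Rightarrow> nat \<Rightarrow> nat \<Rightarrow> nat set" where
  "C1 p e f n g b =
     (\<Union>j\<in>{1..n}. \<Union>i\<in>{0..<dj p f j div 2}.
        scl p n j (clsb p e f g b j i \<union> dbl (2 * p ^ j) (clsb p e f g b j i))) \<union> {0}"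

definition C0 :: "nat \<Rightarrow> nat \<Rightarrow> nat \<Rightarrow> nat \<Rightarrow> nat \<Rightarrow> nat \<Rightarrow> nat set" where
  "C0 p e f n g b =
     (\<Union>j\<in>{1..n}. \<Union>i\<in>{dj p f j div 2..<dj p f j}.
        scl p n j (clsb p e f g b j i \<union> dbl (2 * p ^ j) (clsb p e f g b j i))) \<union> {p ^ n}"

definition C1t :: "nat \<Rightarrow> nat \<Rightarrow> nat \<Rightarrow> nat \<Rightarrow> nat \<Rightarrow> nat \<Rightarrow> nat set" where
  "C1t p e f n g b =
     (\<Union>j\<in>{1..n}. scl p n j
        ((\<Union>i\<in>{0..<dj p f j div 2}. clsb p e f g b j i) \<union>
         (\<Union>i\<in>{dj p f j div 2..<dj p f j}. dbl (2 * p ^ j) (clsb p e f g b j i)))) \<union> {0}"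

definition C0t :: "nat \<Rightarrow> nat \<Rightarrow> nat \<Rightarrow> nat \<Rightarrow> nat \<Rightarrow> nat \<Rightarrow> nat set" where
  "C0t p e f n g b =
     (\<Union>j\<in>{1..n}. scl p n j
        ((\<Union>i\<in>{0..<dj p f j div 2}. dbl (2 * p ^ j) (clsb p e f g b j i)) \<union>
         (\<Union>i\<in>{dj p f j div 2..<dj p f j}. clsb p e f g b j i))) \<union> {p ^ n}"

text \<open>Binary sequence of period N determined by its pair of classes (C0, C1):
  s_i = 0 if i mod N in C0, s_i = 1 if i mod N in C1
  (C0, C1 partition Z_N, as stated in the paper).\<close>
definition seq_of :: "nat \<Rightarrow> nat set \<Rightarrow> nat set \<Rightarrow> nat \<Rightarrow> bool mod_ring" where
  "seq_of N Zs Os i = (if i mod N \<in> Os then 1 else 0)"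

definition s_seq :: "nat \<Rightarrow> nat \<Rightarrow> nat \<Rightarrow> nat \<Rightarrow> nat \<Rightarrow> nat \<Rightarrow> nat \<Rightarrow> bool mod_ring" where
  "s_seq p e f n g b = seq_of (2 * p ^ n) (C0 p e f n g b) (C1 p e f n g b)"

definition st_seq :: "nat \<Rightarrow> nat \<Rightarrow> nat \<Rightarrow> nat \<Rightarrow> nat \<Rightarrow> nat \<Rightarrow> nat \<Rightarrow> bool mod_ring" where
  "st_seq p e f n g b = seq_of (2 * p ^ n) (C0t p e f n g b) (C1t p e f n g b)"

text \<open>F_2 is rendered as bool mod_ring (integers modulo CARD(bool) = 2).
  Linear complexity over F_2 of a sequence of period N:
  L = N - deg gcd(x^N - 1, S(x)), S(x) = sum_{i<N} s_i x^i.\<close>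
definition lin_comp :: "nat \<Rightarrow> (nat \<Rightarrow> bool mod_ring) \<Rightarrow> nat" where
  "lin_comp N s = N - degree (gcd (monom 1 N - 1) (\<Sum>i<N. monom (s i) i))"

end

theory Submission
  imports "HOL-Algebra.Algebraic_Closure_Type" Defs
begin

text \<open>
  Over an algebraic closure of \<open>F\<^sub>2\<close> we have \<open>x\<^bsup>2q\<^esup> - 1 = (x\<^sup>q - 1)\<^sup>2\<close> with \<open>q = p\<^sup>n\<close>, so the degree of
  the gcd counts the roots of unity \<open>y\<close> of order dividing \<open>q\<close> at which the sequence polynomial
  vanishes, twice if its derivative vanishes as well. If \<open>T y\<close> is the sum of \<open>y\<^sup>i\<close> over the odd
  part of the support, the two polynomials take the values \<open>T\<^sup>2 + T + 1\<close> and (for \<open>y \<noteq> 1\<close>)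
  \<open>T\<^sup>2 + T\<close>, and \<open>y\<close> times the derivative is \<open>T\<close> in both cases. So a root of the first polynomial
  has \<open>T y \<in> F\<^sub>4 - F\<^sub>2\<close> and is simple; a root of the second has \<open>T y \<in> F\<^sub>2\<close> and is double iff
  \<open>T y = 0\<close>.

  If \<open>y\<close> has order \<open>p\<^sup>k\<close> with \<open>k \<ge> 2\<close>, then \<open>T y \<notin> F\<^sub>4\<close>: otherwise \<open>T\<close> is invariant under \<open>y \<mapsto> y\<^sup>4\<close>,
  and as \<open>p\<close> is not a Wieferich prime the powers of 4 exhaust \<open>1 + p\<int>\<close> modulo \<open>p\<^sup>k\<close>; averaging \<open>T\<close>
  over these conjugates against a character extracts a geometric sum in a root of unity of order \<open>p\<close>
  whose number of terms is prime to \<open>p\<close>, and this sum does not vanish.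

  If \<open>y = \<gamma>\<close> has order \<open>p\<close>, put \<open>E i = T (\<gamma> ^ (g ^ i))\<close>. Up to a constant in \<open>F\<^sub>2\<close>, \<open>E i\<close> is a sum of
  \<open>f/2\<close> consecutive cyclotomic periods, whence \<open>E (i + f) = E i\<close>, \<open>E (i + f/2) = E i + 1\<close> and
  \<open>E (i + a) = (E i)\<^sup>2\<close> where \<open>g ^ a\<close> is congruent to 2. Since \<open>v = gcd a f\<close>, all claims follow from these three
  rules, except when \<open>f/2\<close> is odd and \<open>v\<close> is 1 or 2; there Fourier inversion on \<open>\<int>/p\<close> shows that \<open>E\<close>
  is not constant on a residue class modulo 2.
\<close>

hide_const (open) Coset.order Divisibility.prime Polynomials.degree Polynomials.lead_coeff up_ring.monom up_ring.coeff

subsection \<open>Multiplicities of roots and the gcd\<close>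

text \<open>\<open>P\<close> splits into linear factors, so its multiset of roots has size
  \<open>degree P\<close>. Any finite superset \<open>A\<close> of the roots is allowed, so that the
  sum may run over all roots of unity instead of the unknown zeros of a gcd.\<close>

lemma degree_eq_sum_order:
  fixes P :: "'a :: alg_closed_field poly"
  assumes "P \<noteq> 0" "finite A" "\<And>x. poly P x = 0 \<Longrightarrow> x \<in> A"
  shows "degree P = (\<Sum>x\<in>A. order x P)"
proof -
  obtain M where M: "size M = degree P" "P = smult (lead_coeff P) (\<Prod>x\<in>#M. [:-x, 1:])"
    using alg_closed_imp_factorization[OF assms(1)] by blast
  have "proots P = proots (\<Prod>x\<in>#M. [:-x, 1:])"
    using assms(1) by (subst M(2)) simp
  also have "\<dots> = M"
  proof (induction M)
    case (add x M)
    have "(\<Prod>x\<in>#M. [:-x, 1:]) \<noteq> 0" by (auto simp: prod_mset_zero_iff)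
    thus ?case using add.IH by (simp add: proots_mult del: mult_pCons_left)
  qed simp
  finally have M': "proots P = M" .
  have "set_mset M \<subseteq> A"
    using assms(1,3) by (auto simp flip: M')
  have "degree P = (\<Sum>x\<in>set_mset M. count M x)"
    using M(1) by (simp add: size_multiset_overloaded_eq)
  also have "\<dots> = (\<Sum>x\<in>A. count M x)"
    using \<open>set_mset M \<subseteq> A\<close> assms(2) by (intro sum.mono_neutral_left) (auto simp: not_in_iff)
  also have "\<dots> = (\<Sum>x\<in>A. order x P)"
    using assms(1) by (simp flip: M')
  finally show ?thesis .
qed

text \<open>If \<open>P = [:-x, 1:] * Q\<close>, then the derivative of \<open>P\<close> takes the
  value \<open>poly Q x\<close> at \<open>x\<close>; its vanishing therefore splits off a second
  linear factor.\<close>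

lemma linear_square_dvd_iff:
  fixes P :: "'a :: field poly"
  shows "[:-x, 1:]\<^sup>2 dvd P \<longleftrightarrow> poly P x = 0 \<and> poly (pderiv P) x = 0"
proof (cases "poly P x = 0")
  case True
  then obtain Q where Q: "P = [:-x, 1:] * Q"
    by (auto simp: poly_eq_0_iff_dvd elim: dvdE)
  have "poly (pderiv P) x = poly Q x"
    unfolding Q pderiv_mult by (simp add: pderiv_pCons)
  moreover have "[:-x, 1:]\<^sup>2 dvd P \<longleftrightarrow> [:-x, 1:] dvd Q"
    unfolding Q power2_eq_square by (subst dvd_mult_cancel_left) auto
  ultimately show ?thesis
    using True by (simp add: poly_eq_0_iff_dvd)
next
  case False
  hence "\<not> [:-x, 1:] dvd P" by (simp add: poly_eq_0_iff_dvd)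
  thus ?thesis using False by (metis dvd_power_same dvd_trans dvd_power pos2)
qed

lemma order_gcd:
  fixes P Q :: "'a :: field_gcd poly"
  assumes "P \<noteq> 0" "Q \<noteq> 0"
  shows "order x (gcd P Q) = min (order x P) (order x Q)"
proof (rule antisym)
  have "gcd P Q \<noteq> 0" using assms by simp
  show "order x (gcd P Q) \<le> min (order x P) (order x Q)"
    using assms by (simp add: dvd_imp_order_le)
  have "[:-x, 1:] ^ min (order x P) (order x Q) dvd gcd P Q"
    using assms by (simp add: order_divides)
  thus "min (order x P) (order x Q) \<le> order x (gcd P Q)"
    using \<open>gcd P Q \<noteq> 0\<close> unfolding order_divides by blast
qed

text \<open>In characteristic 2 this is the square of \<open>monom 1 q - 1\<close>, whose roots are
  simple: for odd \<open>q\<close> its derivative does not vanish at them.\<close>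

lemma order_power_minus_one_squared:
  fixes x :: "'a :: field"
  assumes char: "CHAR('a) = 2" and "odd q"
  shows "order x (monom 1 (2 * q) - 1) = (if x ^ q = 1 then 2 else 0)"
proof -
  let ?P = "monom 1 q - 1 :: 'a poly"
  have q: "q > 0" using \<open>odd q\<close> by (auto intro: odd_pos)
  have two: "(2 :: 'a poly) = 0"
    using of_nat_CHAR[where 'a = "'a poly"] char by simp
  have sq: "monom 1 (2 * q) - 1 = ?P\<^sup>2"
  proof -
    have "?P\<^sup>2 = (monom 1 q)\<^sup>2 + 1 - 2 * monom 1 q"
      by (simp add: power2_diff)
    also have "\<dots> = (monom 1 q)\<^sup>2 + 1 - 2"
      by (simp only: two mult_zero_left)
    also have "\<dots> = (monom 1 q)\<^sup>2 - 1"
      by simp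
    also have "(monom 1 q :: 'a poly)\<^sup>2 = monom 1 (2 * q)"
      by (simp add: monom_power mult.commute)
    finally show ?thesis by simp
  qed
  have nz: "?P \<noteq> 0"
  proof
    assume "?P = 0"
    hence "coeff ?P q = 0" by simp
    thus False using q by (simp add: coeff_1)
  qed
  have "order x ?P = (if x ^ q = 1 then 1 else 0)"
  proof (cases "x ^ q = 1")
    case True
    have "of_nat q \<noteq> (0 :: 'a)"
      using \<open>odd q\<close> char by (simp add: of_nat_eq_0_iff_char_dvd)
    moreover have "x \<noteq> 0" using True q by (auto simp: power_0_left)
    ultimately have "poly (pderiv ?P) x \<noteq> 0"
      by (simp add: pderiv_diff pderiv_monom poly_monom)
    hence "\<not> [:-x, 1:]\<^sup>2 dvd ?P"
      by (simp add: linear_square_dvd_iff)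
    hence "order x ?P < 2"
      by (simp add: order_divides nz)
    moreover have "order x ?P \<noteq> 0"
      using True nz order_root[of ?P x] by (simp add: poly_monom)
    ultimately show ?thesis using True by simp
  next
    case False
    hence "order x ?P = 0" by (intro order_0I) (simp add: poly_monom)
    thus ?thesis using False by simp
  qed
  thus ?thesis
    unfolding sq power2_eq_square by (subst order_mult) (use nz in auto)
qed

text \<open>Every root of the first argument is double, so orders in the gcd are capped at 2, and
  the values of \<open>S\<close> and its derivative decide between 0, 1 and 2.\<close>

lemma degree_gcd_power_minus_one_squared:
  fixes S :: "'a :: {alg_closed_field, field_gcd} poly"
  assumes char: "CHAR('a) = 2" and "odd q" and "S \<noteq> 0"
  shows "degree (gcd (monom 1 (2 * q) - 1) S) =
    (\<Sum>x | x ^ q = 1. if poly S x \<noteq> 0 then 0 else if poly (pderiv S) x \<noteq> 0 then 1 else 2)"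
proof -
  let ?P = "monom 1 (2 * q) - 1 :: 'a poly"
  have q: "q > 0" using \<open>odd q\<close> by (auto intro: odd_pos)
  have nz: "?P \<noteq> 0"
  proof
    assume "?P = 0"
    hence "coeff ?P (2 * q) = 0" by simp
    thus False using q by (simp add: coeff_1)
  qed
  have fin: "finite {x :: 'a. x ^ q = 1}"
    using poly_roots_finite[OF nz] order_power_minus_one_squared[OF char \<open>odd q\<close>]
    by (auto elim!: rev_finite_subset simp: poly_monom power_mult mult.commute[of 2])
  have "degree (gcd ?P S) = (\<Sum>x | x ^ q = 1. order x (gcd ?P S))"
  proof (rule degree_eq_sum_order)
    fix x assume "poly (gcd ?P S) x = 0"
    hence "order x (gcd ?P S) \<noteq> 0" using nz by (metis gcd_eq_0_iff order_root)
    hence "order x ?P \<noteq> 0" using nz \<open>S \<noteq> 0\<close> by (simp add: order_gcd)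
    thus "x \<in> {x. x ^ q = 1}"
      using order_power_minus_one_squared[OF char \<open>odd q\<close>, of x] by (auto split: if_splits)
  qed (use fin nz in auto)
  also have "\<dots> = (\<Sum>x | x ^ q = 1. if poly S x \<noteq> 0 then 0
      else if poly (pderiv S) x \<noteq> 0 then 1 else 2)"
  proof (intro sum.cong refl)
    fix x :: 'a assume "x \<in> {x. x ^ q = 1}"
    hence *: "order x (gcd ?P S) = min 2 (order x S)"
      using nz \<open>S \<noteq> 0\<close> order_power_minus_one_squared[OF char \<open>odd q\<close>, of x] by (simp add: order_gcd)
    have "poly S x = 0 \<longleftrightarrow> 1 \<le> order x S"
      using \<open>S \<noteq> 0\<close> by (simp add: order_root Suc_le_eq)
    moreover have "2 \<le> order x S \<longleftrightarrow> poly S x = 0 \<and> poly (pderiv S) x = 0"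
      using linear_square_dvd_iff[of x S] \<open>S \<noteq> 0\<close> by (simp add: order_divides)
    ultimately show "order x (gcd ?P S) = (if poly S x \<noteq> 0 then 0
        else if poly (pderiv S) x \<noteq> 0 then 1 else 2)"
      unfolding * by auto
  qed
  finally show ?thesis .
qed

instance alg_closure :: (field) field_gcd ..

text \<open>Linear complexity is defined over F_2, but roots are counted in the closure. A gcd
  commutes with field homomorphisms, so its degree survives the passage.\<close>

lemma degree_gcd_to_ac:
  fixes P Q :: "'a :: field_gcd poly"
  shows "degree (gcd P Q) = degree (gcd (map_poly to_ac P) (map_poly to_ac Q))"
proof -
  interpret field_hom' "to_ac :: 'a \<Rightarrow> 'a alg_closure"
    by unfold_locales auto
  show ?thesis by (metis map_poly_gcd degree_map_poly_hom)
qed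

subsection \<open>Characteristic two and roots of unity\<close>

lemma of_nat_odd_char_2:
  assumes "CHAR('a :: ring_1) = 2" "odd m"
  shows "of_nat m = (1 :: 'a)"
proof -
  obtain k where "m = 2 * k + 1" using assms(2) by (rule oddE)
  moreover have "of_nat (2 * k) = (0 :: 'a)"
    unfolding of_nat_eq_0_iff_char_dvd assms(1) by simp
  ultimately show ?thesis by (simp only: of_nat_add add_0 of_nat_1)
qed

lemma add_self_char_2:
  fixes x :: "'a :: ring_1"
  assumes "CHAR('a) = 2"
  shows "x + x = 0"
proof -
  have "x + x = of_nat 2 * x" by (simp add: mult_2)
  also have "of_nat 2 = (0 :: 'a)"
    unfolding of_nat_eq_0_iff_char_dvd assms by simp
  finally show ?thesis by simp
qed

lemma geometric_sum_root_of_unity: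
  fixes w :: "'a :: field"
  assumes "CHAR('a) = 2" "odd q" "w ^ q = 1"
  shows "(\<Sum>m<q. w ^ m) = (if w = 1 then 1 else 0)"
proof (cases "w = 1")
  case True
  have "(\<Sum>m<q. w ^ m) = of_nat q" unfolding True by simp
  thus ?thesis using True of_nat_odd_char_2[OF assms(1,2)] by simp
next
  case False
  thus ?thesis using assms(3) by (simp add: geometric_sum)
qed

lemma square_add_one_char_2:
  fixes x :: "'a :: field"
  assumes "CHAR('a) = 2"
  shows "(x + 1)\<^sup>2 = x\<^sup>2 + 1"
proof -
  have "(x + 1)\<^sup>2 = x\<^sup>2 + 1 + (x + x)" by (simp add: power2_eq_square algebra_simps)
  thus ?thesis by (simp only: add_self_char_2[OF assms] add_0_right)
qed

text \<open>The assumption describes the elements of F_4 outside F_2, on which Frobenius acts as the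
  nontrivial automorphism.\<close>

lemma F4_element_square:
  fixes x :: "'a :: field"
  assumes char: "CHAR('a) = 2" and F4: "x\<^sup>2 + x + 1 = 0"
  shows "x\<^sup>2 = x + 1" "(x\<^sup>2)\<^sup>2 = x"
proof -
  have "x\<^sup>2 + x + 1 + (x + 1) = x\<^sup>2 + ((x + 1) + (x + 1))" by (simp only: add_ac)
  thus sq: "x\<^sup>2 = x + 1" unfolding F4 add_self_char_2[OF char] by simp
  have "(x + 1)\<^sup>2 = x + (1 + 1)"
    unfolding square_add_one_char_2[OF char] sq by (simp only: add_ac)
  thus "(x\<^sup>2)\<^sup>2 = x" unfolding sq by (simp only: add_self_char_2[OF char] add_0_right)
qed

lemma power_eq_if_cong:
  fixes y :: "'a :: monoid_mult"
  assumes "y ^ m = 1" "[k = l] (mod m)"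
  shows "y ^ k = y ^ l"
proof -
  have "y ^ k = y ^ (k mod m)" for k
    using assms(1) by (metis mult_div_mod_eq power_add power_mult power_one mult_1)
  thus ?thesis using assms(2) by (metis cong_def)
qed

lemma cong_one_power_prime_power:
  fixes q x :: nat
  assumes "[x = 1] (mod q ^ j)" "j \<ge> 1"
  shows "[x ^ (q ^ i) = 1] (mod q ^ (j + i))"
proof (induction i)
  case (Suc i)
  define z where "z = int (x ^ (q ^ i))"
  have 1: "int q ^ (j + i) dvd z - 1"
    using Suc.IH unfolding z_def by (metis cong_iff_dvd_diff cong_int_iff of_nat_1 of_nat_power)
  hence "int q dvd z - 1"
    by (rule dvd_trans[rotated]) (use \<open>j \<ge> 1\<close> in simp)
  hence "[z = 1] (mod int q)" by (simp add: cong_iff_dvd_diff)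
  \<comment> \<open>Each step gains one factor \<open>q\<close>: in
    \<open>z ^ q - 1 = (z - 1) * (\<Sum>k<q. z ^ k)\<close> the sum has \<open>q\<close> terms, all
    congruent to 1.\<close>
  hence "[(\<Sum>k<q. z ^ k) = (\<Sum>k<q. 1 ^ k)] (mod int q)"
    by (intro cong_sum cong_pow)
  hence "int q dvd (\<Sum>k<q. z ^ k)"
    by (simp add: cong_dvd_iff)
  with 1 have "int q ^ (j + i) * int q dvd (z - 1) * (\<Sum>k<q. z ^ k)"
    by (rule mult_dvd_mono)
  also have "\<dots> = z ^ q - 1" by (simp add: power_diff_1_eq)
  finally have "[z ^ q = 1] (mod int q ^ (j + Suc i))"
    by (simp add: cong_iff_dvd_diff mult.commute)
  also have "z ^ q = int (x ^ (q ^ Suc i))"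
    by (simp add: z_def mult.commute flip: power_mult)
  finally show ?case by (metis cong_int_iff of_nat_1 of_nat_power)
qed (use assms in simp)

subsection \<open>The cyclotomic classes\<close>

locale gen_cyclotomic =
  fixes p e f n g b :: nat
  assumes prime_p: "prime p" and odd_p: "odd p" and p_eq: "p = e * f + 1"
    and e_pos: "e > 0" and f_pos: "f > 0" and even_f: "even f"
    and non_wieferich: "\<not> [2 ^ (p - 1) = 1] (mod p ^ 2)"
    and n_pos: "n \<ge> 1" and odd_g: "odd g" and primroot_n: "residue_primroot (p ^ n) g"
begin

abbreviation d :: "nat \<Rightarrow> nat" where "d \<equiv> dj p f"

lemma p_gt_2: "p > 2"
  using prime_gt_1_nat[OF prime_p] odd_p by (cases "p = 2") auto

lemma p_minus_1: "p - 1 = e * f" "p - Suc 0 = e * f"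
  using p_eq by simp_all

lemma d_pos: "d j > 0"
  using f_pos p_gt_2 by (simp add: dj_def)

lemma even_d: "even (d j)"
  using even_f by (simp add: dj_def)

lemma d_mult: "1 \<le> l \<Longrightarrow> l \<le> j \<Longrightarrow> d j = p ^ (j - l) * d l"
  by (simp add: dj_def flip: power_add mult.assoc)

lemma totient_prime_power_eq: "j \<ge> 1 \<Longrightarrow> totient (p ^ j) = e * d j"
  by (cases j) (auto simp: totient_prime_power_Suc[OF prime_p] dj_def p_minus_1 simp del: power_Suc)

lemma coprime_p_g: "coprime p g"
  using primroot_n n_pos by (auto simp: residue_primroot_def)

text \<open>Primitivity descends from level \<open>n\<close>: if \<open>m\<close> is the order at
  level \<open>j\<close>, then \<open>m * p ^ (n - j)\<close> is an exponent killing
  \<open>g\<close> at level \<open>n\<close>, which bounds \<open>m\<close> from below.\<close>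

lemma ord_g:
  assumes "1 \<le> j" "j \<le> n"
  shows "ord (p ^ j) g = e * d j"
proof -
  define m where "m = ord (p ^ j) g"
  have cop: "coprime (p ^ j) g" using coprime_p_g by simp
  have "[(g ^ m) ^ p ^ (n - j) = 1] (mod p ^ (j + (n - j)))"
    by (rule cong_one_power_prime_power) (use assms ord[of g "p ^ j"] in \<open>auto simp: m_def\<close>)
  hence "ord (p ^ n) g dvd m * p ^ (n - j)"
    using assms by (simp add: ord_divides' flip: power_mult)
  moreover have "ord (p ^ n) g = e * d n"
    using primroot_n n_pos by (simp add: residue_primroot_def totient_prime_power_eq)
  moreover have "d n = d j * p ^ (n - j)"
    using assms by (simp add: d_mult[of j n] mult.commute)
  ultimately have "e * d j dvd m"
    using p_gt_2 by (simp flip: mult.assoc)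
  moreover have "m dvd e * d j"
    using order_divides_totient[OF cop] assms by (simp add: m_def totient_prime_power_eq)
  ultimately show ?thesis unfolding m_def by (rule dvd_antisym[symmetric])
qed

lemma g_power_cong_iff:
  assumes "1 \<le> j" "j \<le> n"
  shows "[g ^ k = g ^ l] (mod p ^ j) \<longleftrightarrow> [k = l] (mod e * d j)"
  using order_divides_expdiff[of "p ^ j" g k l] ord_g[OF assms] coprime_p_g by simp

lemma power_g_power_cong:
  fixes y :: "'a :: monoid_mult"
  assumes "1 \<le> j" "j \<le> n" "y ^ (p ^ j) = 1" "[k = l] (mod e * d j)"
  shows "y ^ (g ^ k) = y ^ (g ^ l)"
  using assms g_power_cong_iff by (intro power_eq_if_cong[of y "p ^ j"]) auto

text \<open>
  The index \<open>(j, i, t)\<close> stands for the \<open>t\<close>-th element of the class of level \<open>j\<close> with subscript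
  \<open>i + b\<close>. Its odd and even representatives modulo \<open>2p\<^sup>n\<close> reduce to \<open>res\<close> and twice \<open>res\<close> modulo \<open>p\<^sup>n\<close>.
\<close>

definition expo :: "nat \<Rightarrow> nat \<Rightarrow> nat \<Rightarrow> nat" where
  "expo j i t = (i + b) mod d j + t * d j"

definition res :: "nat \<times> nat \<times> nat \<Rightarrow> nat" where
  "res = (\<lambda>(j, i, t). p ^ (n - j) * (g ^ expo j i t mod p ^ j))"

definition oddr :: "nat \<times> nat \<times> nat \<Rightarrow> nat" where
  "oddr = (\<lambda>(j, i, t). p ^ (n - j) * (g ^ expo j i t mod (2 * p ^ j)))"

definition evenr :: "nat \<times> nat \<times> nat \<Rightarrow> nat" where
  "evenr = (\<lambda>(j, i, t). p ^ (n - j) * (2 * g ^ expo j i t mod (2 * p ^ j)))"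

definition all_idx :: "(nat \<times> nat \<times> nat) set" where
  "all_idx = (SIGMA j:{1..n}. {0..<d j} \<times> {0..<e})"

definition low_idx :: "(nat \<times> nat \<times> nat) set" where
  "low_idx = (SIGMA j:{1..n}. {0..<d j div 2} \<times> {0..<e})"

definition high_idx :: "(nat \<times> nat \<times> nat) set" where
  "high_idx = (SIGMA j:{1..n}. {d j div 2..<d j} \<times> {0..<e})"

lemma idx_split: "all_idx = low_idx \<union> high_idx" "low_idx \<inter> high_idx = {}"
  "finite low_idx" "finite high_idx"
  by (fastforce simp: all_idx_def low_idx_def high_idx_def)+

lemma expo_less: "t < e \<Longrightarrow> expo j i t < e * d j"
proof -
  assume "t < e"
  have "expo j i t < d j + t * d j" using d_pos[of j] by (simp add: expo_def)
  also have "\<dots> = Suc t * d j" by simp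
  also have "\<dots> \<le> e * d j" using \<open>t < e\<close> by (intro mult_right_mono) auto
  finally show ?thesis .
qed

lemma expo_inject:
  assumes "expo j i t = expo j i' t'" "i < d j" "i' < d j"
  shows "i = i' \<and> t = t'"
proof -
  have "(i + b) mod d j = expo j i t mod d j" "t = expo j i t div d j"
       "(i' + b) mod d j = expo j i' t' mod d j" "t' = expo j i' t' div d j"
    using d_pos[of j] by (simp_all add: expo_def)
  hence "(i + b) mod d j = (i' + b) mod d j" "t = t'" using assms(1) by simp_all
  moreover from this(1) have "[i = i'] (mod d j)"
    by (metis cong_def cong_add_rcancel_nat)
  ultimately show ?thesis using assms(2,3) by (simp add: cong_def)
qed

lemma not_dvd_g_power: "\<not> p dvd g ^ k"
  using prime_p coprime_p_g by (metis prime_dvd_power coprime_absorb_left not_prime_unit)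

lemma not_dvd_g_power_mod: "j \<ge> 1 \<Longrightarrow> \<not> p dvd g ^ k mod p ^ j"
  using not_dvd_g_power[of k] by (simp add: dvd_mod_iff dvd_power)

text \<open>The exact power of \<open>p\<close> in \<open>res\<close> reveals the level
  \<open>j\<close>. Then the exponent of \<open>g\<close> is known modulo \<open>e * d j\<close>, a
  bound that \<open>expo\<close> never reaches, and its quotient and remainder by \<open>d j\<close>
  give \<open>t\<close> and \<open>i\<close>.\<close>

lemma inj_on_res: "inj_on res all_idx"
proof -
  have less: False
    if "j < j'" "j \<ge> 1" "j' \<le> n" "p ^ (n - j) * u = p ^ (n - j') * u'" "\<not> p dvd u'" for j j' u u'
  proof -
    have "p ^ (n - j) = p ^ (n - j') * p ^ (j' - j)"
      using that by (simp flip: power_add)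
    hence "u' = p ^ (j' - j) * u"
      using that(4) p_gt_2 by simp
    thus False using that by (simp add: dvd_power)
  qed
  show ?thesis
  proof (rule inj_onI)
    fix x x' assume "x \<in> all_idx" "x' \<in> all_idx" "res x = res x'"
    moreover obtain j i t j' i' t' where x: "x = (j, i, t)" "x' = (j', i', t')"
      by (metis prod.exhaust)
    ultimately have a: "(j, i, t) \<in> all_idx" "(j', i', t') \<in> all_idx"
      "res (j, i, t) = res (j', i', t')" by auto
    hence b: "j \<ge> 1" "j \<le> n" "j' \<ge> 1" "j' \<le> n" "i < d j" "i' < d j'" "t < e" "t' < e"
      by (auto simp: all_idx_def)
    have eq: "p ^ (n - j) * (g ^ expo j i t mod p ^ j) = p ^ (n - j') * (g ^ expo j' i' t' mod p ^ j')"
      using a(3) by (simp add: res_def)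
    have "j = j'"
      using less[OF _ b(1,4) eq not_dvd_g_power_mod[OF b(3)]] less[OF _ b(3,2) eq[symmetric] not_dvd_g_power_mod[OF b(1)]]
      by (metis linorder_neqE_nat)
    moreover from eq this have "[g ^ expo j i t = g ^ expo j i' t'] (mod p ^ j)"
      using p_gt_2 by (simp add: cong_def)
    hence "[expo j i t = expo j i' t'] (mod e * d j)"
      using b by (simp add: g_power_cong_iff)
    hence "expo j i t = expo j i' t'"
      using expo_less b by (simp add: cong_def)
    ultimately show "x = x'"
      using expo_inject b x by blast
  qed
qed

lemma card_all_idx: "card all_idx = p ^ n - 1"
proof -
  have "card all_idx = (\<Sum>j\<in>{1..n}. d j * e)"
    by (simp add: all_idx_def card_SigmaI)
  also have "\<dots> = (\<Sum>j\<in>{1..n}. p ^ (j - 1) * (p - 1))"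
    using p_eq by (intro sum.cong) (auto simp: dj_def mult_ac)
  also have "\<dots> = (\<Sum>j<n. p ^ j * (p - 1))"
    by (rule sum.reindex_bij_witness[of _ Suc "\<lambda>j. j - 1"]) auto
  also have "\<dots> = p ^ n - 1"
  proof (induction n)
    case (Suc n)
    have "p ^ n \<le> p * p ^ n" "1 \<le> p ^ n" using p_gt_2 by auto
    with Suc show ?case by (simp add: algebra_simps diff_mult_distrib2)
  qed simp
  finally show ?thesis .
qed

text \<open>Injectivity and the count \<open>p ^ n - 1\<close> replace a direct proof of
  surjectivity.\<close>

lemma res_image: "res ` all_idx = {1..<p ^ n}"
proof (rule card_subset_eq)
  show "res ` all_idx \<subseteq> {1..<p ^ n}"
  proof clarify
    fix j i t assume "(j, i, t) \<in> all_idx"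
    hence j: "1 \<le> j" "j \<le> n" by (auto simp: all_idx_def)
    have "g ^ expo j i t mod p ^ j \<noteq> 0"
      using not_dvd_g_power_mod[OF j(1)] by (metis dvd_0_right)
    moreover have "p ^ (n - j) * (g ^ expo j i t mod p ^ j) < p ^ (n - j) * p ^ j"
      using p_gt_2 by (intro mult_strict_left_mono) auto
    hence "p ^ (n - j) * (g ^ expo j i t mod p ^ j) < p ^ n"
      using j by (simp flip: power_add)
    ultimately show "res (j, i, t) \<in> {1..<p ^ n}"
      using p_gt_2 by (simp add: res_def Suc_le_eq)
  qed
  show "card (res ` all_idx) = card {1..<p ^ n}"
    by (simp add: card_image inj_on_res card_all_idx)
qed simp


section \<open>Odd and even representatives modulo \<open>2 * p ^ n\<close>\<close>

lemma oddr_cong: "x \<in> all_idx \<Longrightarrow> [oddr x = res x] (mod p ^ n)"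
proof -
  assume "x \<in> all_idx"
  then obtain j i t where x: "x = (j, i, t)" "j \<le> n" by (auto simp: all_idx_def)
  have "[g ^ expo j i t mod (2 * p ^ j) = g ^ expo j i t mod p ^ j] (mod p ^ j)"
    by (simp add: cong_def mod_mod_cancel)
  hence "[oddr x = res x] (mod p ^ (n - j) * p ^ j)"
    unfolding oddr_def res_def x prod.case by (rule cong_cmult_leftI)
  thus ?thesis using x(2) by (simp flip: power_add)
qed

lemma evenr_cong: "x \<in> all_idx \<Longrightarrow> [evenr x = 2 * res x] (mod p ^ n)"
proof -
  assume "x \<in> all_idx"
  then obtain j i t where x: "x = (j, i, t)" "j \<le> n" by (auto simp: all_idx_def)
  have "[2 * g ^ expo j i t mod (2 * p ^ j) = 2 * (g ^ expo j i t mod p ^ j)] (mod p ^ j)"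
    by (simp add: cong_def mod_mod_cancel mod_mult_right_eq)
  hence "[p ^ (n - j) * (2 * g ^ expo j i t mod (2 * p ^ j)) =
      p ^ (n - j) * (2 * (g ^ expo j i t mod p ^ j))] (mod p ^ (n - j) * p ^ j)"
    by (rule cong_cmult_leftI)
  thus ?thesis using x by (simp add: evenr_def res_def mult_ac flip: power_add)
qed

lemma inj_on_oddr: "inj_on oddr all_idx"
proof (rule inj_onI)
  fix x y assume xy: "x \<in> all_idx" "y \<in> all_idx" "oddr x = oddr y"
  hence "[res x = res y] (mod p ^ n)"
    using oddr_cong by (metis cong_sym cong_trans)
  moreover have "res x \<in> {1..<p ^ n}" "res y \<in> {1..<p ^ n}"
    using xy res_image by blast+
  ultimately have "res x = res y" by (simp add: cong_def)
  thus "x = y" using inj_on_res xy by (auto dest: inj_onD)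
qed

lemma inj_on_evenr: "inj_on evenr all_idx"
proof (rule inj_onI)
  fix x y assume xy: "x \<in> all_idx" "y \<in> all_idx" "evenr x = evenr y"
  hence "[2 * res x = 2 * res y] (mod p ^ n)"
    using evenr_cong by (metis cong_sym cong_trans)
  moreover have "coprime 2 (p ^ n)" using odd_p by simp
  ultimately have "[res x = res y] (mod p ^ n)"
    using cong_mult_lcancel_nat by blast
  moreover have "res x \<in> {1..<p ^ n}" "res y \<in> {1..<p ^ n}"
    using xy res_image by blast+
  ultimately have "res x = res y" by (simp add: cong_def)
  thus "x = y" using inj_on_res xy by (auto dest: inj_onD)
qed

lemma odd_oddr: "odd (oddr x)"
proof -
  obtain j i t where x: "x = (j, i, t)" by (metis prod.exhaust)
  have "odd (g ^ expo j i t mod (2 * p ^ j))"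
    using odd_g by (simp add: dvd_mod_iff)
  thus ?thesis using odd_p by (simp add: oddr_def x)
qed

lemma even_evenr: "even (evenr x)"
  by (cases x) (simp add: evenr_def dvd_mod_iff)

lemma evenr_nonzero: "x \<in> all_idx \<Longrightarrow> evenr x \<noteq> 0"
proof
  assume x: "x \<in> all_idx" "evenr x = 0"
  hence "p ^ n dvd 2 * res x"
    using evenr_cong[of x] by (metis cong_0_iff cong_sym)
  moreover have "coprime (p ^ n) 2" using odd_p by simp
  ultimately have "p ^ n dvd res x" by (simp add: coprime_dvd_mult_right_iff)
  moreover have "res x \<in> {1..<p ^ n}" using x res_image by blast
  ultimately show False by (auto dest: dvd_imp_le)
qed

lemma scaled_less:
  assumes "j \<le> n" shows "p ^ (n - j) * (k mod (2 * p ^ j)) < 2 * p ^ n"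
proof -
  have "p ^ (n - j) * (k mod (2 * p ^ j)) < p ^ (n - j) * (2 * p ^ j)"
    using p_gt_2 by (intro mult_strict_left_mono) auto
  also have "\<dots> = 2 * p ^ n" using assms by (simp flip: power_add)
  finally show ?thesis .
qed

lemma oddr_less: "x \<in> all_idx \<Longrightarrow> oddr x < 2 * p ^ n"
  unfolding all_idx_def oddr_def using scaled_less by auto

lemma evenr_less: "x \<in> all_idx \<Longrightarrow> evenr x < 2 * p ^ n"
proof -
  assume "x \<in> all_idx"
  then obtain j i t where x: "x = (j, i, t)" "j \<le> n" by (auto simp: all_idx_def)
  show ?thesis unfolding evenr_def x(1) prod.case by (rule scaled_less[OF x(2)])
qed

section \<open>The supports of the two sequences\<close>

lemma clsb_eq: "clsb p e f g b j i = (\<lambda>t. g ^ expo j i t mod (2 * p ^ j)) ` {0..<e}"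
  unfolding clsb_def cls_def cls0_def image_image expo_def
  by (simp add: mod_mult_right_eq power_add)

lemma dbl_clsb_eq:
  "dbl (2 * p ^ j) (clsb p e f g b j i) = (\<lambda>t. 2 * g ^ expo j i t mod (2 * p ^ j)) ` {0..<e}"
  unfolding dbl_def clsb_eq image_image by (simp only: mod_mult_right_eq)

lemma scl_clsb_eq:
  "j \<le> n \<Longrightarrow> scl p n j (clsb p e f g b j i) = (\<lambda>t. oddr (j, i, t)) ` {0..<e}"
  unfolding scl_def clsb_eq image_image oddr_def by (simp add: scaled_less)

lemma scl_dbl_clsb_eq:
  "j \<le> n \<Longrightarrow> scl p n j (dbl (2 * p ^ j) (clsb p e f g b j i)) = (\<lambda>t. evenr (j, i, t)) ` {0..<e}"
  unfolding scl_def dbl_clsb_eq image_image evenr_def prod.case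
  by (intro image_cong refl mod_less scaled_less)

lemma scl_Un: "scl p n j (A \<union> B) = scl p n j A \<union> scl p n j B"
  by (auto simp: scl_def)

lemma scl_UN: "scl p n j (\<Union>i\<in>I. A i) = (\<Union>i\<in>I. scl p n j (A i))"
  by (auto simp: scl_def)

lemma C1_eq: "C1 p e f n g b = insert 0 (oddr ` low_idx \<union> evenr ` low_idx)"
proof -
  have "C1 p e f n g b = (\<Union>j\<in>{1..n}. \<Union>i\<in>{0..<d j div 2}.
      (\<lambda>t. oddr (j, i, t)) ` {0..<e} \<union> (\<lambda>t. evenr (j, i, t)) ` {0..<e}) \<union> {0}"
    unfolding C1_def scl_Un by (intro arg_cong2[of _ _ _ _ "(\<union>)"] SUP_cong refl)
      (simp_all add: scl_clsb_eq scl_dbl_clsb_eq)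
  also have "\<dots> = insert 0 (oddr ` low_idx \<union> evenr ` low_idx)"
    unfolding low_idx_def by fastforce
  finally show ?thesis .
qed

lemma C1t_eq: "C1t p e f n g b = insert 0 (oddr ` low_idx \<union> evenr ` high_idx)"
proof -
  have "C1t p e f n g b = (\<Union>j\<in>{1..n}. (\<Union>i\<in>{0..<d j div 2}. (\<lambda>t. oddr (j, i, t)) ` {0..<e}) \<union>
      (\<Union>i\<in>{d j div 2..<d j}. (\<lambda>t. evenr (j, i, t)) ` {0..<e})) \<union> {0}"
    unfolding C1t_def scl_Un scl_UN by (intro arg_cong2[of _ _ _ _ "(\<union>)"] SUP_cong refl)
      (simp_all add: scl_clsb_eq scl_dbl_clsb_eq)
  also have "\<dots> = insert 0 (oddr ` low_idx \<union> evenr ` high_idx)"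
    unfolding low_idx_def high_idx_def by fastforce
  finally show ?thesis .
qed

text \<open>Parity separates the images of \<open>oddr\<close> and \<open>evenr\<close>, and neither
  contains 0, so the three pieces of the support do not overlap.\<close>

lemma sum_sequence_support:
  fixes h :: "nat \<Rightarrow> 'b :: comm_monoid_add"
  assumes "A \<subseteq> all_idx" "B \<subseteq> all_idx"
  shows "(\<Sum>i\<in>insert 0 (oddr ` A \<union> evenr ` B). h i) =
    h 0 + ((\<Sum>x\<in>A. h (oddr x)) + (\<Sum>x\<in>B. h (evenr x)))"
proof -
  have fin: "finite A" "finite B"
    using assms idx_split by (metis finite_Un finite_subset)+
  have "0 \<notin> oddr ` A \<union> evenr ` B"
    using odd_oddr evenr_nonzero assms by (metis Un_iff dvd_0_right imageE subsetD)
  hence "(\<Sum>i\<in>insert 0 (oddr ` A \<union> evenr ` B). h i) = h 0 + (\<Sum>i\<in>oddr ` A \<union> evenr ` B. h i)"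
    using fin by simp
  also have "oddr ` A \<inter> evenr ` B = {}"
    using odd_oddr even_evenr by (metis disjoint_iff imageE)
  hence "(\<Sum>i\<in>oddr ` A \<union> evenr ` B. h i) = (\<Sum>i\<in>oddr ` A. h i) + (\<Sum>i\<in>evenr ` B. h i)"
    using fin by (intro sum.union_disjoint) auto
  also have "(\<Sum>i\<in>oddr ` A. h i) = (\<Sum>x\<in>A. h (oddr x))"
    using inj_on_subset[OF inj_on_oddr assms(1)] by (simp add: sum.reindex)
  also have "(\<Sum>i\<in>evenr ` B. h i) = (\<Sum>x\<in>B. h (evenr x))"
    using inj_on_subset[OF inj_on_evenr assms(2)] by (simp add: sum.reindex)
  finally show ?thesis .
qed

section \<open>The support polynomial and its derivative at roots of unity\<close>

definition supp_poly :: "(nat \<times> nat \<times> nat) set \<Rightarrow> (nat \<times> nat \<times> nat) set \<Rightarrow> 'a :: field poly" where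
  "supp_poly A B = (\<Sum>i\<in>insert 0 (oddr ` A \<union> evenr ` B). monom 1 i)"

text \<open>Modulo \<open>p ^ n\<close> the exponents are \<open>res x\<close> and
  \<open>2 * res x\<close>, and Frobenius turns a sum of squares into a square; the summand 1 comes
  from the exponent 0. With \<open>A = low_idx\<close>, the choices \<open>low_idx\<close> and
  \<open>high_idx\<close> for \<open>B\<close> give the two sequences.\<close>

lemma poly_supp_poly:
  fixes y :: "'a :: field"
  assumes "CHAR('a) = 2" "y ^ (p ^ n) = 1" "A \<subseteq> all_idx" "B \<subseteq> all_idx"
  shows "poly (supp_poly A B) y = 1 + (\<Sum>x\<in>A. y ^ res x) + (\<Sum>x\<in>B. y ^ res x)\<^sup>2"
proof -
  have "poly (supp_poly A B) y = (\<Sum>i\<in>insert 0 (oddr ` A \<union> evenr ` B). y ^ i)"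
    by (simp only: supp_poly_def poly_sum poly_monom mult_1)
  also have "\<dots> = 1 + ((\<Sum>x\<in>A. y ^ oddr x) + (\<Sum>x\<in>B. y ^ evenr x))"
    using sum_sequence_support[OF assms(3,4), of "\<lambda>i. y ^ i"] by simp
  also have "(\<Sum>x\<in>A. y ^ oddr x) = (\<Sum>x\<in>A. y ^ res x)"
    using assms oddr_cong by (intro sum.cong power_eq_if_cong[of y "p ^ n"]) auto
  also have "(\<Sum>x\<in>B. y ^ evenr x) = (\<Sum>x\<in>B. (y ^ res x)\<^sup>2)"
    unfolding power_mult[symmetric]
    using assms evenr_cong by (intro sum.cong power_eq_if_cong[of y "p ^ n"]) (auto simp: mult.commute)
  also have "\<dots> = (\<Sum>x\<in>B. y ^ res x)\<^sup>2"
    using assms(1) by (simp add: freshmans_dream_sum)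
  finally show ?thesis by (simp add: add.assoc)
qed

text \<open>Multiplication by \<open>y\<close> restores the exponents lowered by differentiation. In
  characteristic 2 the even exponents, among them 0, disappear and the odd ones receive the
  coefficient 1.\<close>

lemma pderiv_supp_poly:
  fixes y :: "'a :: field"
  assumes "CHAR('a) = 2" "y ^ (p ^ n) = 1" "A \<subseteq> all_idx" "B \<subseteq> all_idx"
  shows "y * poly (pderiv (supp_poly A B)) y = (\<Sum>x\<in>A. y ^ res x)"
proof -
  have "y * poly (pderiv (supp_poly A B)) y =
      (\<Sum>i\<in>insert 0 (oddr ` A \<union> evenr ` B). of_nat i * y ^ i)"
    unfolding supp_poly_def pderiv_sum poly_sum sum_distrib_left
  proof (intro sum.cong refl)
    fix i show "y * poly (pderiv (monom 1 i)) y = of_nat i * y ^ i"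
      by (cases i) (simp_all add: pderiv_monom poly_monom)
  qed
  also have "\<dots> = (\<Sum>x\<in>A. of_nat (oddr x) * y ^ oddr x) + (\<Sum>x\<in>B. of_nat (evenr x) * y ^ evenr x)"
    using sum_sequence_support[OF assms(3,4), of "\<lambda>i. of_nat i * y ^ i"] by simp
  also have "(\<Sum>x\<in>B. of_nat (evenr x) * y ^ evenr x) = 0"
    using even_evenr assms(1) by (intro sum.neutral) (metis mult_zero_left of_nat_eq_0_iff_char_dvd)
  also have "(\<Sum>x\<in>A. of_nat (oddr x) * y ^ oddr x) = (\<Sum>x\<in>A. y ^ res x)"
  proof (intro sum.cong refl)
    fix x assume x: "x \<in> A"
    have "of_nat (oddr x) = (1 :: 'a)" by (rule of_nat_odd_char_2[OF assms(1) odd_oddr])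
    moreover have "y ^ oddr x = y ^ res x"
      using assms oddr_cong x by (intro power_eq_if_cong[of y "p ^ n"]) blast+
    ultimately show "of_nat (oddr x) * y ^ oddr x = y ^ res x" by simp
  qed
  finally show ?thesis by simp
qed

text \<open>By \<open>res_image\<close> this is the full geometric sum over the exponents below
  \<open>p ^ n\<close> without its initial term 1.\<close>

lemma sum_all_idx:
  fixes y :: "'a :: field"
  assumes "CHAR('a) = 2" "y ^ (p ^ n) = 1"
  shows "(\<Sum>x\<in>all_idx. y ^ res x) = (if y = 1 then 0 else 1)"
proof -
  have "(\<Sum>x\<in>all_idx. y ^ res x) = (\<Sum>i\<in>{1..<p ^ n}. y ^ i)"
    using inj_on_res unfolding res_image[symmetric] by (simp add: sum.reindex)
  moreover have "1 + (\<Sum>i\<in>{1..<p ^ n}. y ^ i) = (\<Sum>i<p ^ n. y ^ i)"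
    using p_gt_2 sum.atLeast_Suc_lessThan[of 0 "p ^ n" "\<lambda>i. y ^ i"] by (simp add: lessThan_atLeast0)
  moreover have "(\<Sum>i<p ^ n. y ^ i) = (if y = 1 then 1 else 0)"
    using odd_p by (intro geometric_sum_root_of_unity assms) simp
  ultimately have "1 + (\<Sum>x\<in>all_idx. y ^ res x) = (if y = 1 then 1 else 0)"
    by simp
  moreover have "(1 :: 'a) + 1 = 0" by (rule add_self_char_2[OF assms(1)])
  ultimately show ?thesis
    by (metis add_left_cancel add_0_right)
qed

lemma map_poly_seq_of:
  assumes "A \<subseteq> all_idx" "B \<subseteq> all_idx"
  shows "map_poly to_ac (\<Sum>i<2 * p ^ n. monom (seq_of (2 * p ^ n) Zs (insert 0 (oddr ` A \<union> evenr ` B)) i) i)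
    = supp_poly A B"
proof -
  let ?C = "insert 0 (oddr ` A \<union> evenr ` B)"
  have sub: "?C \<subseteq> {..<2 * p ^ n}"
    using assms oddr_less evenr_less p_gt_2 by auto
  have "(\<Sum>i<2 * p ^ n. monom (seq_of (2 * p ^ n) Zs ?C i) i) = (\<Sum>i<2 * p ^ n. if i \<in> ?C then monom 1 i else 0)"
    by (intro sum.cong) (auto simp: seq_of_def)
  also have "\<dots> = (\<Sum>i\<in>{..<2 * p ^ n} \<inter> ?C. monom 1 i)"
    by (rule sum.inter_restrict[symmetric]) simp
  also have "{..<2 * p ^ n} \<inter> ?C = ?C" using sub by blast
  finally show ?thesis
    unfolding supp_poly_def
    by (intro poly_eqI) (simp only: coeff_map_poly to_ac_0 to_ac_1 coeff_sum to_ac_sum coeff_monom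
        if_distrib[of to_ac])
qed

end

section \<open>Roots of unity of exact prime power order\<close>

lemma power_eq_one_iff_prime_power_dvd:
  fixes y :: "'a :: field"
  assumes "prime q" "k \<ge> 1" "y ^ (q ^ k) = 1" "y ^ (q ^ (k - 1)) \<noteq> 1"
  shows "y ^ m = 1 \<longleftrightarrow> q ^ k dvd m"
proof
  assume m: "y ^ m = 1"
  show "q ^ k dvd m"
  proof (rule ccontr)
    assume nd: "\<not> q ^ k dvd m"
    have "m > 0" by (rule ccontr) (use nd in simp)
    then obtain i m' where m': "m = m' * q ^ i" "\<not> q dvd m'"
      using prime_power_canonical[OF \<open>prime q\<close>] by blast
    have "i < k"
    proof (rule ccontr)
      assume "\<not> i < k"
      hence "q ^ k dvd q ^ i" by (intro le_imp_power_dvd) simp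
      hence "q ^ k dvd m" unfolding m'(1) by (rule dvd_mult)
      thus False using nd by contradiction
    qed
    \<comment> \<open>If \<open>q\<close> divides \<open>m\<close> only \<open>i < k\<close> times,
      then \<open>z\<close>, which satisfies \<open>z ^ q = 1\<close>, is also killed by the
      cofactor \<open>m'\<close> prime to \<open>q\<close>. This forces
      \<open>z = 1\<close>.\<close>
    define z where "z = y ^ (q ^ (k - 1))"
    have "q ^ (k - 1) = q ^ i * q ^ (k - 1 - i)"
      unfolding power_add[symmetric] using \<open>i < k\<close> by simp
    hence "q ^ (k - 1) * m' = m * q ^ (k - 1 - i)" using m' by (simp only: mult_ac)
    hence "z ^ m' = (y ^ m) ^ (q ^ (k - 1 - i))"
      unfolding z_def power_mult[symmetric] by (simp only:)
    hence "z ^ m' = 1" by (simp only: m power_one)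
    moreover have "q ^ (k - 1) * q = q ^ k" using assms(2) by (intro power_minus_mult) simp
    hence "z ^ q = 1" using assms(3) unfolding z_def power_mult[symmetric] by (simp only:)
    moreover have "coprime m' q"
      using prime_imp_coprime[OF \<open>prime q\<close> m'(2)] by (simp only: coprime_commute)
    then obtain a where "[m' * a = 1] (mod q)"
      using cong_solve_coprime_nat[of m' q] by (auto simp only: One_nat_def)
    ultimately have "(z ^ m') ^ a = z ^ 1" "z ^ m' = 1"
      using power_eq_if_cong[of z q "m' * a" 1] unfolding power_mult[symmetric] by blast+
    hence "z = 1" by (simp only: power_one power_one_right)
    thus False using assms(4) z_def by simp
  qed
next
  assume "q ^ k dvd m"
  then obtain r where "m = q ^ k * r" by blast
  thus "y ^ m = 1" using assms(3) by (simp only: power_mult power_one)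
qed

lemma power_eq_iff_cong_prime_power:
  fixes y :: "'a :: field"
  assumes "prime q" "k \<ge> 1" "y ^ (q ^ k) = 1" "y ^ (q ^ (k - 1)) \<noteq> 1"
  shows "y ^ u = y ^ v \<longleftrightarrow> [u = v] (mod q ^ k)"
proof
  assume eq: "y ^ u = y ^ v"
  have "y \<noteq> 0" using assms(1,3) by (auto simp: power_0_left prime_gt_0_nat split: if_splits)
  have *: "[u = v] (mod q ^ k)" if "u \<le> v" "y ^ u = y ^ v" for u v
  proof -
    have "y ^ (v - u) = 1" using that \<open>y \<noteq> 0\<close> by (simp add: power_diff)
    thus ?thesis
      using power_eq_one_iff_prime_power_dvd[OF assms] that(1) by (metis cong_altdef_nat cong_sym)
  qed
  show "[u = v] (mod q ^ k)"
    using *[of u v] *[of v u] eq by (metis cong_sym nle_le)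
qed (rule power_eq_if_cong[OF assms(3)])

context gen_cyclotomic
begin

subsection \<open>The sum over the odd part of the support\<close>

lemma index_exists:
  assumes "1 \<le> k" "k \<le> n" "coprime c p"
  obtains i where "[g ^ i = c] (mod p ^ k)"
proof -
  have "residue_primroot (p ^ k) g"
    using ord_g[OF assms(1,2)] coprime_p_g assms p_gt_2
    by (simp add: residue_primroot_def totient_prime_power_eq)
  moreover have "p ^ k > 1" using p_gt_2 assms(1) by (intro one_less_power) auto
  ultimately have "bij_betw (\<lambda>i. g ^ i mod p ^ k) {..<totient (p ^ k)} (totatives (p ^ k))"
    by (intro residue_primroot_is_generator)
  moreover have "c mod p ^ k \<in> totatives (p ^ k)"
  proof -
    have "coprime c (p ^ k)" using assms by simp
    hence cop: "coprime (c mod p ^ k) (p ^ k)"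
      using p_gt_2 by (subst coprime_mod_left_iff) auto
    have "c mod p ^ k \<noteq> 0"
    proof
      assume "c mod p ^ k = 0"
      hence "p ^ k = 1" using cop by (simp only: coprime_0_left_iff nat_dvd_1_iff_1)
      thus False using \<open>p ^ k > 1\<close> by (simp only: less_irrefl)
    qed
    moreover have "c mod p ^ k \<le> p ^ k"
      using p_gt_2 by (intro less_imp_le mod_less_divisor) simp
    ultimately show ?thesis using cop unfolding in_totatives_iff by blast
  qed
  ultimately have "c mod p ^ k \<in> (\<lambda>i. g ^ i mod p ^ k) ` {..<totient (p ^ k)}"
    unfolding bij_betw_def by blast
  then obtain i where "c mod p ^ k = g ^ i mod p ^ k" by blast
  thus ?thesis using that by (simp add: cong_def)
qed

text \<open>Passing to indices with respect to \<open>g\<close> makes the congruence linear. The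
  index \<open>i\<close> of \<open>c\<close> is a multiple of \<open>e * f\<close>, so the index
  \<open>a\<close> of 4 has to be inverted only modulo \<open>p ^ (k - 1)\<close>, which is possible
  once \<open>p\<close> does not divide \<open>a\<close>.\<close>

lemma powers_of_4_cover:
  assumes "2 \<le> k" "k \<le> n" "[c = 1] (mod p)"
  obtains s where "[4 ^ s = c] (mod p ^ k)"
proof -
  have k1: "1 \<le> k" using assms(1) by simp
  have cop2: "coprime 2 p" using odd_p by simp
  hence "coprime (2 * 2) p" by (simp only: coprime_mult_left_iff)
  hence cop4: "coprime 4 p" by simp
  obtain a where a: "[g ^ a = 4] (mod p ^ k)"
    using index_exists[OF k1 assms(2) cop4] by blast
  \<comment> \<open>If \<open>p\<close> divided the index of 4, then \<open>4 ^ (p - 1)\<close> would be 1 modulo \<open>p\<^sup>2\<close>.\<close>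
  have "\<not> p dvd a"
  proof
    assume "p dvd a"
    then obtain a' where a': "a = p * a'" by blast
    define x where "x = (2 :: nat) ^ (p - 1)"
    have "2 \<le> n" using assms by simp
    have c1: "[g ^ (a * (p - 1)) = g ^ 0] (mod p ^ 2)"
    proof -
      have "a * (p - 1) = e * d 2 * a'" unfolding a' p_minus_1 dj_def by simp
      hence "[a * (p - 1) = 0] (mod e * d 2)" unfolding cong_0_iff by (simp only: dvd_triv_left)
      thus ?thesis
        using g_power_cong_iff[of 2 "a * (p - 1)" 0] \<open>2 \<le> n\<close> by simp
    qed
    have c2: "[g ^ (a * (p - 1)) = 4 ^ (p - 1)] (mod p ^ 2)"
      unfolding power_mult by (rule cong_pow[OF cong_dvd_modulus_nat[OF a le_imp_power_dvd[OF assms(1)]]])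
    have "[4 ^ (p - 1) = g ^ 0] (mod p ^ 2)"
      by (rule cong_trans[OF cong_sym[OF c2] c1])
    moreover have "x ^ 2 = (2 ^ 2) ^ (p - 1)"
      unfolding x_def power_mult[symmetric] by (simp only: mult.commute)
    hence "x ^ 2 = 4 ^ (p - 1)" by simp
    ultimately have "[x ^ 2 = 1] (mod p ^ 2)" by (simp only: power_0)
    hence "[int (x ^ 2) = int 1] (mod int (p ^ 2))" by (simp only: cong_int_iff)
    hence "int (p ^ 2) dvd int (x ^ 2) - 1"
      by (simp only: cong_iff_dvd_diff of_nat_1)
    also have "int (x ^ 2) - 1 = (int x - 1) * (int x + 1)"
      by (simp add: power2_eq_square algebra_simps)
    finally have "int (p ^ 2) dvd (int x - 1) * (int x + 1)" .
    \<comment> \<open>By Fermat \<open>x + 1\<close> is congruent to 2 modulo \<open>p\<close>,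
      hence prime to \<open>p\<close>, so all of \<open>p ^ 2\<close> divides
      \<open>x - 1\<close>.\<close>
    moreover have "coprime (int (p ^ 2)) (int x + 1)"
    proof -
      have "[x = 1] (mod p)"
        unfolding x_def using p_gt_2 by (intro fermat_theorem prime_p) (auto dest: dvd_imp_le)
      hence "[1 + 1 = x + 1] (mod p)" by (intro cong_add cong_refl) (rule cong_sym)
      hence "coprime (x + 1) p"
        by (rule cong_imp_coprime) (use cop2 in \<open>simp only: one_add_one\<close>)
      hence "coprime p (x + 1)" by (simp only: coprime_commute)
      hence "coprime (p ^ 2) (x + 1)" by simp
      hence "coprime (int (p ^ 2)) (int (x + 1))" by (simp only: coprime_int_iff)
      thus ?thesis by (simp only: of_nat_add of_nat_1)
    qed
    ultimately have "int (p ^ 2) dvd int x - 1" by (simp only: coprime_dvd_mult_left_iff)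
    hence "[int x = int 1] (mod int (p ^ 2))" by (simp only: cong_iff_dvd_diff of_nat_1)
    hence "[x = 1] (mod p ^ 2)" by (simp only: cong_int_iff)
    thus False using non_wieferich x_def by simp
  qed
  have "coprime c p"
    using cong_imp_coprime[OF cong_sym[OF assms(3)]] by simp
  then obtain i where i: "[g ^ i = c] (mod p ^ k)"
    using index_exists[OF k1 assms(2)] by blast
  have "p dvd p ^ k" using k1 by (simp add: dvd_power)
  hence "[g ^ i = g ^ 0] (mod p ^ 1)"
    using cong_trans[OF cong_dvd_modulus_nat[OF i] assms(3)] by simp
  hence "e * d 1 dvd i"
    using g_power_cong_iff[of 1 i 0] n_pos by (simp add: cong_0_iff)
  then obtain i' where i': "i = e * f * i'" by (auto simp: dj_def)
  have "coprime a (p ^ (k - 1))"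
    using prime_imp_coprime[OF prime_p \<open>\<not> p dvd a\<close>] by (simp add: coprime_commute)
  then obtain u where "[a * u = 1] (mod p ^ (k - 1))"
    using cong_solve_coprime_nat[of a "p ^ (k - 1)"] by (auto simp only: One_nat_def)
  hence "[a * u * i' = 1 * i'] (mod p ^ (k - 1))" by (intro cong_mult) auto
  hence "[e * f * (a * u * i') = e * f * (1 * i')] (mod e * f * p ^ (k - 1))"
    by (rule cong_cmult_leftI)
  moreover have "e * f * (a * u * i') = a * (e * f * u * i')" by (simp add: mult_ac)
  moreover have "e * f * p ^ (k - 1) = e * d k" by (simp add: dj_def mult_ac)
  ultimately have "[a * (e * f * u * i') = i] (mod e * d k)"
    using i' by (simp only: mult_1)
  hence c3: "[g ^ (a * (e * f * u * i')) = g ^ i] (mod p ^ k)"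
    using g_power_cong_iff[OF k1 assms(2)] by blast
  have c4: "[g ^ (a * (e * f * u * i')) = 4 ^ (e * f * u * i')] (mod p ^ k)"
    unfolding power_mult[of g a] using a by (intro cong_pow)
  show ?thesis by (rule that[OF cong_trans[OF cong_sym[OF c4] cong_trans[OF c3 i]]])
qed

text \<open>For \<open>y\<close> of order \<open>p ^ j\<close> this is a Gauss period. The subscript
  \<open>k\<close> is not reduced modulo \<open>d j\<close>, so that conjugation acts by plain
  addition; \<open>G_cong\<close> supplies the reduction.\<close>

definition G :: "nat \<Rightarrow> nat \<Rightarrow> 'a :: field \<Rightarrow> 'a" where
  "G j k y = (\<Sum>t<e. y ^ (g ^ (k + t * d j)))"

definition T :: "'a :: field \<Rightarrow> 'a" where
  "T y = (\<Sum>x\<in>low_idx. y ^ res x)"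

text \<open>A shift of the subscript by \<open>d j\<close> moves each term to the next and closes up
  after \<open>e\<close> terms, as \<open>g\<close> has order \<open>e * d j\<close> modulo
  \<open>p ^ j\<close>.\<close>

lemma G_cong:
  fixes z :: "'a :: field"
  assumes "1 \<le> j" "j \<le> n" "z ^ (p ^ j) = 1" "[k = l] (mod d j)"
  shows "G j k z = G j l z"
proof -
  have step: "G j (k + d j) z = G j k z" for k
  proof -
    define h where "h t = z ^ (g ^ (k + t * d j))" for t
    have "G j (k + d j) z = (\<Sum>t<e. h (Suc t))"
      by (simp add: G_def h_def add_ac)
    moreover have "h 0 + (\<Sum>t<e. h (Suc t)) = (\<Sum>t<e. h t) + h e"
      using sum.lessThan_Suc_shift[of h e] by simp
    moreover have "h e = h 0"
      unfolding h_def using assms by (intro power_g_power_cong[of j]) (auto simp: cong_def)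
    ultimately show ?thesis by (simp add: G_def h_def)
  qed
  have "G j (k + m * d j) z = G j k z" for k m
  proof (induction m)
    case (Suc m)
    thus ?case using step[of "k + m * d j"] by (simp add: add_ac)
  qed simp
  hence "G j k z = G j (k mod d j) z" for k
    by (metis mod_mult_div_eq add.commute mult.commute)
  thus ?thesis using assms(4) by (metis cong_def)
qed

text \<open>The terms agree one by one, since \<open>p\<close> is congruent to 1 modulo \<open>e\<close>.\<close>

lemma G_level:
  fixes z :: "'a :: field"
  assumes "1 \<le> l" "l \<le> j" "j \<le> n" "z ^ (p ^ l) = 1"
  shows "G j k z = G l k z"
  unfolding G_def
proof (intro sum.cong refl)
  fix t
  have "[e * f + 1 = 0 + 1] (mod e)" by (intro cong_add) (simp_all add: cong_0_iff)
  hence "[p = 1] (mod e)" by (simp only: p_eq add_0)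
  hence "[p ^ (j - l) = 1 ^ (j - l)] (mod e)" by (rule cong_pow)
  hence "[d l * p ^ (j - l) = d l * 1] (mod d l * e)"
    by (intro cong_cmult_leftI) simp
  hence "[d j = d l] (mod e * d l)" using assms by (simp add: d_mult[of l j] mult.commute)
  hence "[k + t * d j = k + t * d l] (mod e * d l)" by (intro cong_add cong_mult) auto
  thus "z ^ g ^ (k + t * d j) = z ^ g ^ (k + t * d l)"
    using assms by (intro power_g_power_cong[of l]) auto
qed

lemma G_power: "G j k (z ^ (g ^ i)) = G j (k + i) z"
  unfolding G_def power_mult[symmetric] power_add[symmetric] by (simp only: add_ac)

text \<open>The factor \<open>p ^ (n - j)\<close> of \<open>res\<close> moves into the base. The
  order of the new base divides \<open>p ^ j\<close>, so the powers of \<open>g\<close> matter only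
  modulo \<open>p ^ j\<close>.\<close>

lemma T_eq:
  fixes y :: "'a :: field"
  assumes "y ^ (p ^ n) = 1"
  shows "T y = (\<Sum>j\<in>{1..n}. \<Sum>i<d j div 2. G j (b + i) (y ^ (p ^ (n - j))))"
proof -
  have "T y = (\<Sum>j\<in>{1..n}. \<Sum>i\<in>{0..<d j div 2}. \<Sum>t\<in>{0..<e}. y ^ res (j, i, t))"
    unfolding T_def low_idx_def
    using sum.Sigma[of "{1..n}" "\<lambda>j. {0..<d j div 2} \<times> {0..<e}" "\<lambda>j w. y ^ res (j, w)"]
    by (simp add: sum.cartesian_product' split_beta)
  also have "\<dots> = (\<Sum>j\<in>{1..n}. \<Sum>i\<in>{0..<d j div 2}. G j (b + i) (y ^ (p ^ (n - j))))"
  proof (intro sum.cong refl)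
    fix j i assume j: "j \<in> {1..n}"
    let ?z = "y ^ (p ^ (n - j))"
    have z: "?z ^ (p ^ j) = 1" using assms j by (simp flip: power_mult power_add)
    have "(\<Sum>t\<in>{0..<e}. y ^ res (j, i, t)) = (\<Sum>t\<in>{0..<e}. ?z ^ (g ^ expo j i t))"
      unfolding res_def prod.case power_mult
      by (intro sum.cong refl power_eq_if_cong[OF z]) (simp add: cong_def)
    also have "\<dots> = G j ((i + b) mod d j) ?z"
      by (simp add: G_def expo_def lessThan_atLeast0)
    also have "\<dots> = G j (b + i) ?z"
      using j z by (intro G_cong) (auto simp: cong_def add.commute)
    finally show "(\<Sum>t\<in>{0..<e}. y ^ res (j, i, t)) = G j (b + i) ?z" .
  qed
  finally show ?thesis by (simp add: lessThan_atLeast0)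
qed

lemma T_square:
  fixes y :: "'a :: field"
  assumes "CHAR('a) = 2"
  shows "T (y\<^sup>2) = (T y)\<^sup>2"
proof -
  have "T (y\<^sup>2) = (\<Sum>x\<in>low_idx. (y ^ res x)\<^sup>2)"
    unfolding T_def by (intro sum.cong refl) (metis power_mult mult.commute)
  also have "\<dots> = (T y)\<^sup>2"
    unfolding T_def using assms by (simp add: freshmans_dream_sum)
  finally show ?thesis .
qed

end

text \<open>Each \<open>u\<close> leads to a geometric sum in \<open>w\<close>, where
  \<open>w ^ q = 1\<close>. For odd \<open>q\<close> that sum is 1 or 0 in characteristic 2, so the
  average needs no normalising factor.\<close>

lemma roots_of_unity_filter:
  fixes y \<xi> :: "'a :: field"
  assumes "CHAR('a) = 2" "odd q" "\<xi> ^ q = 1"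
  shows "(\<Sum>m<q. inverse (\<xi> ^ r) ^ m * (y * \<xi> ^ m) ^ u) = (if \<xi> ^ u = \<xi> ^ r then y ^ u else 0)"
proof -
  define w where "w = \<xi> ^ u * inverse (\<xi> ^ r)"
  have "q > 0" using assms(2) by (rule odd_pos)
  hence "\<xi> \<noteq> 0" using assms(3) by (cases "\<xi> = 0") (auto simp: power_0_left)
  have pw: "(\<xi> ^ l) ^ q = 1" for l
    using assms(3) by (metis mult.commute power_mult power_one)
  have "w ^ q = 1"
    unfolding w_def power_mult_distrib power_inverse pw by simp
  have "inverse (\<xi> ^ r) ^ m * (y * \<xi> ^ m) ^ u = y ^ u * w ^ m" for m
  proof -
    have "(\<xi> ^ m) ^ u = (\<xi> ^ u) ^ m" by (simp only: power_mult[symmetric] mult.commute)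
    thus ?thesis unfolding w_def power_mult_distrib by (simp only: mult_ac)
  qed
  hence "(\<Sum>m<q. inverse (\<xi> ^ r) ^ m * (y * \<xi> ^ m) ^ u) = y ^ u * (\<Sum>m<q. w ^ m)"
    by (simp only: sum_distrib_left)
  also have "\<dots> = y ^ u * (if w = 1 then 1 else 0)"
    by (simp only: geometric_sum_root_of_unity[OF assms(1,2) \<open>w ^ q = 1\<close>])
  also have "w = 1 \<longleftrightarrow> \<xi> ^ u = \<xi> ^ r"
    unfolding w_def using \<open>\<xi> \<noteq> 0\<close> by (simp add: field_simps)
  finally show ?thesis by simp
qed

lemma sum_over_multiples:
  fixes h :: "nat \<Rightarrow> 'b :: comm_monoid_add"
  assumes "D > 0" "\<And>m. m * D < N \<longleftrightarrow> m < M"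
  shows "(\<Sum>i<N. if D dvd i then h (i div D) else 0) = (\<Sum>m<M. h m)"
proof -
  have "(\<Sum>i<N. if D dvd i then h (i div D) else 0) = (\<Sum>i\<in>{i \<in> {..<N}. D dvd i}. h (i div D))"
    by (rule sum.inter_filter[symmetric]) simp
  also have "\<dots> = (\<Sum>m<M. h m)"
    using assms by (intro sum.reindex_bij_witness[of _ "\<lambda>m. m * D" "\<lambda>i. i div D"])
      (auto simp flip: assms(2))
  finally show ?thesis .
qed

context gen_cyclotomic
begin

lemma T_power_4:
  fixes y :: "'a :: field"
  assumes "CHAR('a) = 2" "T y ^ 4 = T y"
  shows "T (y ^ (4 ^ s)) = T y"
proof (induction s)
  case (Suc s)
  have "y ^ (4 ^ Suc s) = ((y ^ (4 ^ s))\<^sup>2)\<^sup>2"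
    by (simp flip: power_mult)
  hence "T (y ^ (4 ^ Suc s)) = (T y ^ 2) ^ 2"
    by (simp only: T_square[OF assms(1)] Suc.IH)
  also have "\<dots> = T y ^ 4" by (simp flip: power_mult)
  finally show ?case using assms(2) by simp
qed simp

subsection \<open>Roots of unity of order at least \<open>p\<^sup>2\<close>\<close>

text \<open>
  The number \<open>w\<close> is an inverse of \<open>e\<close> modulo \<open>p\<close>: it moves the subscript \<open>m * d (k - 1)\<close> within its
  class modulo \<open>d k\<close> to a multiple of \<open>e * d (k - 1)\<close>, for which the power of \<open>g\<close> is 1 modulo \<open>p ^ (k - 1)\<close>.
\<close>

lemma unity_root_power_shift:
  fixes y :: "'a :: field"
  assumes "2 \<le> k" "k \<le> n" "y ^ (p ^ k) = 1" "y ^ (p ^ (k - 1)) \<noteq> 1"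
  defines "w \<equiv> 1 + (e - 1) * f"
  obtains \<delta> where "\<delta> ^ p = 1" "\<delta> \<noteq> 1"
    "\<forall>m. y ^ (g ^ (b + e * d (k - 1) * (w * m))) = y ^ (g ^ b) * \<delta> ^ m"
proof -
  have k1: "1 \<le> k - 1" "k - 1 \<le> n" "1 \<le> k" using assms by auto
  have pk: "p ^ k = p ^ (k - 1) * p" using assms(1) by (intro power_minus_mult[symmetric]) simp
  \<comment> \<open>\<open>C\<close> is 1 modulo \<open>p ^ (k - 1)\<close> but not modulo
    \<open>p ^ k\<close>. Hence \<open>C ^ m\<close> is congruent to \<open>1 + m * (C - 1)\<close>
    modulo \<open>p ^ k\<close>, and the powers of \<open>y\<close> form a geometric progression
    with ratio \<open>\<delta>\<close>.\<close>
  define C where "C = g ^ (e * d (k - 1) * w)"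
  have "g > 0" using odd_g by (rule odd_pos)
  hence "C \<ge> 1" unfolding C_def by (simp add: Suc_le_eq)
  have "[e * d (k - 1) * w = 0] (mod e * d (k - 1))" by (simp add: cong_0_iff)
  hence "[C = g ^ 0] (mod p ^ (k - 1))"
    unfolding C_def using g_power_cong_iff[OF k1(1,2)] by blast
  hence "p ^ (k - 1) dvd C - 1" using \<open>C \<ge> 1\<close> by (simp add: cong_altdef_nat)
  then obtain c where c: "C - 1 = p ^ (k - 1) * c" by blast
  have C: "C = 1 + p ^ (k - 1) * c" using c \<open>C \<ge> 1\<close> by simp
  define \<delta> where "\<delta> = y ^ (g ^ b * (C - 1))"
  have ew: "e * w = 1 + p * (e - 1)"
    using e_pos unfolding w_def p_eq by (cases e) (simp_all add: algebra_simps)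
  have "\<not> p dvd w"
  proof
    assume "p dvd w"
    hence "p dvd 1 + p * (e - 1)" unfolding ew[symmetric] by (rule dvd_mult)
    hence "p dvd 1" by (metis dvd_add_left_iff dvd_triv_left)
    thus False using p_gt_2 by simp
  qed
  have "\<not> p ^ k dvd g ^ b * (C - 1)"
  proof
    assume "p ^ k dvd g ^ b * (C - 1)"
    moreover have "coprime (p ^ k) (g ^ b)" using coprime_p_g by simp
    ultimately have "p ^ k dvd C - 1" by (simp only: coprime_dvd_mult_right_iff)
    hence "[C = g ^ 0] (mod p ^ k)" using \<open>C \<ge> 1\<close> by (simp add: cong_altdef_nat)
    hence "[e * d (k - 1) * w = 0] (mod e * d k)"
      unfolding C_def using g_power_cong_iff[OF k1(3) assms(2)] by blast
    hence "e * d k dvd e * d (k - 1) * w" by (simp only: cong_0_iff)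
    moreover have "k - (k - 1) = 1" using assms(1) by simp
    hence "d k = p * d (k - 1)" using d_mult[OF k1(1), of k] by simp
    ultimately have "(e * d (k - 1)) * p dvd (e * d (k - 1)) * w" by (simp only: mult_ac)
    hence "p dvd w" using e_pos d_pos[of "k - 1"] by simp
    thus False using \<open>\<not> p dvd w\<close> by contradiction
  qed
  hence "\<delta> \<noteq> 1"
    unfolding \<delta>_def using power_eq_one_iff_prime_power_dvd[OF prime_p k1(3) assms(3,4)] by blast
  moreover have "\<delta> ^ p = 1"
  proof -
    have "g ^ b * (C - 1) * p = p ^ k * (g ^ b * c)" unfolding c pk by (simp only: mult_ac)
    hence "\<delta> ^ p = (y ^ (p ^ k)) ^ (g ^ b * c)"
      unfolding \<delta>_def power_mult[symmetric] by (simp only:)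
    thus ?thesis by (simp only: assms(3) power_one)
  qed
  moreover have "y ^ (g ^ (b + e * d (k - 1) * (w * m))) = y ^ (g ^ b) * \<delta> ^ m" for m
  proof -
    have eq: "g ^ (b + e * d (k - 1) * (w * m)) = g ^ b * C ^ m" for m
      unfolding C_def power_add power_mult by simp
    have "y ^ (g ^ b * C ^ m) = y ^ (g ^ b) * \<delta> ^ m"
    proof (induction m)
      case (Suc m)
      have "[C = 1] (mod p)"
      proof -
        have "p dvd p ^ (k - 1) * c" by (intro dvd_mult2 dvd_power disjI1) (use assms(1) in arith)
        thus ?thesis unfolding C by (simp add: cong_altdef_nat)
      qed
      hence "[C ^ m = 1 ^ m] (mod p)" by (rule cong_pow)
      hence "[p ^ (k - 1) * C ^ m = p ^ (k - 1) * 1 ^ m] (mod p ^ k)"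
        unfolding pk by (rule cong_cmult_leftI)
      hence "[g ^ b * c * (p ^ (k - 1) * C ^ m) = g ^ b * c * (p ^ (k - 1) * 1 ^ m)] (mod p ^ k)"
        by (rule cong_mult[OF cong_refl])
      hence "[g ^ b * (C - 1) * C ^ m = g ^ b * (C - 1)] (mod p ^ k)"
        unfolding c by (simp only: mult_ac power_one mult_1)
      hence "y ^ (g ^ b * (C - 1) * C ^ m) = \<delta>"
        unfolding \<delta>_def by (rule power_eq_if_cong[OF assms(3)])
      moreover have "C ^ Suc m = C ^ m + (C - 1) * C ^ m"
        using \<open>C \<ge> 1\<close> by (simp add: algebra_simps)
      hence "g ^ b * C ^ Suc m = g ^ b * C ^ m + g ^ b * (C - 1) * C ^ m"
        by (simp only: distrib_left mult.assoc)
      ultimately show ?case by (simp only: power_add Suc.IH power_Suc) simp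
    qed simp
    thus ?thesis by (simp only: eq)
  qed
  ultimately show ?thesis by (intro that allI)
qed

text \<open>Twice the number is \<open>p ^ l + 1\<close>, which is prime to \<open>p\<close>. It is
  the length of the final geometric sum in \<open>T_outside_F4\<close>.\<close>

lemma not_p_dvd_half_Suc_power: "l \<ge> 1 \<Longrightarrow> \<not> p dvd (p ^ l + 1) div 2"
proof
  assume "l \<ge> 1" "p dvd (p ^ l + 1) div 2"
  hence "p dvd 2 * ((p ^ l + 1) div 2)" by (intro dvd_mult)
  also have "2 * ((p ^ l + 1) div 2) = p ^ l + 1" using odd_p by simp
  finally have "p dvd 1"
    using \<open>l \<ge> 1\<close> by (metis dvd_add_right_iff dvd_power less_eq_Suc_le One_nat_def)
  thus False using p_gt_2 by simp
qed

text \<open>The weighted average of \<open>T\<close> over the conjugates is evaluated twice: by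
  invariance it is \<open>T y\<close> times a vanishing character sum, and by \<open>T_eq\<close> it
  is a nonzero geometric sum.\<close>

lemma T_outside_F4:
  fixes y :: "'a :: field"
  assumes char: "CHAR('a) = 2"
    and k: "2 \<le> k" "k \<le> n" and y: "y ^ (p ^ k) = 1" "y ^ (p ^ (k - 1)) \<noteq> 1"
  shows "T y ^ 4 \<noteq> T y"
proof
  assume T4: "T y ^ 4 = T y"
  define Q where "Q = p ^ (k - 1)"
  define \<xi> where "\<xi> = y ^ p"
  define r where "r = g ^ b"
  define c where "c m = inverse (\<xi> ^ r) ^ m" for m
  define w where "w = 1 + (e - 1) * f"
  have k1: "1 \<le> k - 1" "k - 1 \<le> n" "1 \<le> k" using k by auto
  have pk: "p * Q = p ^ k" using k(1) unfolding Q_def by (intro power_minus_mult[of k p, unfolded mult.commute[of _ p]]) simp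
  have "odd Q" unfolding Q_def using odd_p by simp
  have "p dvd Q" unfolding Q_def by (intro dvd_power disjI1) (use k in arith)
  have \<xi>: "\<xi> ^ Q = 1" unfolding \<xi>_def power_mult[symmetric] pk by (rule y)
  have \<xi>_iff: "\<xi> ^ u = \<xi> ^ v \<longleftrightarrow> [u = v] (mod Q)" for u v
  proof -
    have "\<xi> ^ u = \<xi> ^ v \<longleftrightarrow> [p * u = p * v] (mod p ^ k)"
      unfolding \<xi>_def power_mult[symmetric]
      by (rule power_eq_iff_cong_prime_power[OF prime_p k1(3) y])
    also have "\<dots> \<longleftrightarrow> [u = v] (mod Q)"
      unfolding pk[symmetric] cong_def using p_gt_2 by (simp add: mod_mult_mult1)
    finally show ?thesis .
  qed
  \<comment> \<open>Averaging over the conjugates \<open>y * \<xi> ^ m\<close> keeps the exponents that are \<open>g ^ b\<close> modulo \<open>Q\<close>.\<close>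
  have filt: "(\<Sum>m<Q. c m * (y * \<xi> ^ m) ^ u) = (if [u = r] (mod Q) then y ^ u else 0)" for u
    unfolding c_def roots_of_unity_filter[OF char \<open>odd Q\<close> \<xi>] \<xi>_iff by (rule refl)
  have r: "\<not> p dvd r" unfolding r_def by (rule not_dvd_g_power)
  have ys: "(y * \<xi> ^ m) ^ (p ^ k) = 1" for m
  proof -
    have "(\<xi> ^ m) ^ (p ^ k) = (y ^ (p ^ k)) ^ (p * m)"
      unfolding \<xi>_def power_mult[symmetric] by (simp only: mult_ac)
    thus ?thesis by (simp only: power_mult_distrib y(1) power_one mult_1)
  qed
  have yn: "(y * \<xi> ^ m) ^ (p ^ n) = 1" for m
  proof -
    have "p ^ n = p ^ k * p ^ (n - k)" using k(2) by (simp flip: power_add)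
    thus ?thesis using ys[of m] by (simp only: power_mult power_one)
  qed
  have Tinv: "T (y * \<xi> ^ m) = T y" for m
  proof -
    \<comment> \<open>The conjugate equals \<open>y ^ (1 + p * m)\<close>, so it is reached from
      \<open>y\<close> by repeated fourth powers, which fix \<open>T\<close>.\<close>
    have "[1 + p * m = 1] (mod p)" by (simp add: cong_altdef_nat)
    then obtain s where s: "[4 ^ s = 1 + p * m] (mod p ^ k)"
      by (rule powers_of_4_cover[OF k])
    have "y * \<xi> ^ m = y ^ (1 + p * m)" unfolding \<xi>_def power_add power_mult by simp
    also have "\<dots> = y ^ (4 ^ s)" by (rule power_eq_if_cong[OF y(1) cong_sym[OF s]])
    finally show ?thesis using T_power_4[OF char T4] by (simp only:)
  qed
  have "(\<Sum>m<Q. c m) = (if [0 = r] (mod Q) then 1 else 0)"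
    using filt[of 0] by simp
  moreover have "\<not> [0 = r] (mod Q)"
  proof
    assume "[0 = r] (mod Q)"
    hence "[r = 0] (mod p)" using \<open>p dvd Q\<close> by (rule cong_sym[OF cong_dvd_modulus_nat])
    thus False using r by (simp only: cong_0_iff)
  qed
  ultimately have PT0: "(\<Sum>m<Q. c m * T (y * \<xi> ^ m)) = 0"
    by (simp add: Tinv flip: sum_distrib_right)
  have PT: "(\<Sum>m<Q. c m * T (y * \<xi> ^ m)) =
      (\<Sum>j\<in>{1..n}. \<Sum>i<d j div 2. \<Sum>m<Q. c m * G j (b + i) ((y * \<xi> ^ m) ^ (p ^ (n - j))))"
  proof -
    have "(\<Sum>m<Q. c m * T (y * \<xi> ^ m)) =
      (\<Sum>m<Q. \<Sum>j\<in>{1..n}. \<Sum>i<d j div 2. c m * G j (b + i) ((y * \<xi> ^ m) ^ (p ^ (n - j))))"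
      unfolding T_eq[OF yn] sum_distrib_left by (rule refl)
    also have "\<dots> = (\<Sum>j\<in>{1..n}. \<Sum>m<Q. \<Sum>i<d j div 2. c m * G j (b + i) ((y * \<xi> ^ m) ^ (p ^ (n - j))))"
      by (rule sum.swap)
    also have "\<dots> = (\<Sum>j\<in>{1..n}. \<Sum>i<d j div 2. \<Sum>m<Q. c m * G j (b + i) ((y * \<xi> ^ m) ^ (p ^ (n - j))))"
      by (rule sum.cong[OF refl sum.swap])
    finally show ?thesis .
  qed
  have GP: "(\<Sum>m<Q. c m * G j l ((y * \<xi> ^ m) ^ a)) =
      (\<Sum>t<e. if [a * g ^ (l + t * d j) = r] (mod Q) then y ^ (a * g ^ (l + t * d j)) else 0)" for j l a
  proof -
    have "(\<Sum>m<Q. c m * G j l ((y * \<xi> ^ m) ^ a)) =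
        (\<Sum>m<Q. \<Sum>t<e. c m * (y * \<xi> ^ m) ^ (a * g ^ (l + t * d j)))"
      unfolding G_def sum_distrib_left power_mult by (rule refl)
    also have "\<dots> = (\<Sum>t<e. \<Sum>m<Q. c m * (y * \<xi> ^ m) ^ (a * g ^ (l + t * d j)))"
      by (rule sum.swap)
    finally show ?thesis unfolding filt .
  qed
  \<comment> \<open>Below level \<open>n\<close> all exponents are divisible by \<open>p\<close>
    while \<open>r\<close> is not, so the filter discards them.\<close>
  have PG0: "(\<Sum>m<Q. c m * G j (b + i) ((y * \<xi> ^ m) ^ (p ^ (n - j)))) = 0" if "j < n" for i j
  proof -
    have "\<not> [p ^ (n - j) * u = r] (mod Q)" for u
    proof
      assume "[p ^ (n - j) * u = r] (mod Q)"
      hence "[p ^ (n - j) * u = r] (mod p)" using \<open>p dvd Q\<close> by (rule cong_dvd_modulus_nat)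
      moreover have "p dvd p ^ (n - j) * u" using that by (intro dvd_mult2 dvd_power) simp
      ultimately have "p dvd r" using cong_dvd_iff by blast
      thus False using r by contradiction
    qed
    thus ?thesis unfolding GP by simp
  qed
  have "(\<Sum>j\<in>{1..n}. \<Sum>i<d j div 2. \<Sum>m<Q. c m * G j (b + i) ((y * \<xi> ^ m) ^ (p ^ (n - j)))) =
      (\<Sum>j\<in>{n}. \<Sum>i<d j div 2. \<Sum>m<Q. c m * G j (b + i) ((y * \<xi> ^ m) ^ (p ^ (n - j))))"
    using n_pos by (intro sum.mono_neutral_right ballI sum.neutral PG0) auto
  also have "\<dots> = (\<Sum>i<d n div 2. \<Sum>m<Q. c m * G n (b + i) (y * \<xi> ^ m))" by simp
  finally have sum0: "(\<Sum>i<d n div 2. \<Sum>m<Q. c m * G n (b + i) (y * \<xi> ^ m)) = 0"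
    using PT PT0 by (simp only:)
  \<comment> \<open>\<open>h m\<close> is the one term that survives in the class with
    \<open>i = m * d (k - 1)\<close>. Its exponent arises by moving \<open>i\<close> modulo
    \<open>d k\<close> to a multiple of \<open>e * d (k - 1)\<close>.\<close>
  define h where "h m = y ^ (g ^ (b + e * d (k - 1) * (w * m)))" for m
  have key: "[g ^ (b + l) = r] (mod Q) \<longleftrightarrow> e * d (k - 1) dvd l" for l
    unfolding r_def Q_def g_power_cong_iff[OF k1(1,2)]
    by (simp add: cong_altdef_nat)
  have dn: "d n = p ^ (n - (k - 1)) * d (k - 1)" by (rule d_mult[OF k1(1,2)])
  have dk: "d k = p * d (k - 1)"
  proof -
    have "k - (k - 1) = 1" using k by simp
    thus ?thesis using d_mult[OF k1(1), of k] by simp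
  qed
  have H: "(\<Sum>m<Q. c m * G n (b + i) (y * \<xi> ^ m)) = (if d (k - 1) dvd i then h (i div d (k - 1)) else 0)" for i
  proof (cases "d (k - 1) dvd i")
    case False
    have "\<not> e * d (k - 1) dvd i + t * d n" for t
    proof
      assume "e * d (k - 1) dvd i + t * d n"
      hence "d (k - 1) dvd i + t * d n" by (rule dvd_mult_right)
      moreover have "d (k - 1) dvd t * d n" unfolding dn by simp
      ultimately show False using False by (simp only: dvd_add_left_iff)
    qed
    hence "\<not> [1 * g ^ (b + i + t * d n) = r] (mod Q)" for t
      using key[of "i + t * d n"] by (simp add: add.assoc)
    thus ?thesis using GP[of n "b + i" 1] False by simp
  next
    case True
    then obtain m where m: "i = d (k - 1) * m" by blast
    have ew: "e * w = 1 + p * (e - 1)"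
      using e_pos unfolding w_def p_eq by (cases e) (simp_all add: algebra_simps)
    have shift: "e * d (k - 1) * (w * m) = i + d k * ((e - 1) * m)"
    proof -
      have "e * d (k - 1) * (w * m) = (e * w) * (d (k - 1) * m)" by (simp only: mult_ac)
      thus ?thesis unfolding ew m dk by (simp add: algebra_simps)
    qed
    have cong: "[b + i = b + e * d (k - 1) * (w * m)] (mod d k)"
      unfolding shift add.assoc[symmetric] cong_def by simp
    have "G n (b + i) (y * \<xi> ^ m') = G k (b + e * d (k - 1) * (w * m)) (y * \<xi> ^ m')" for m'
      using G_level[OF k1(3) k(2) order_refl ys] G_cong[OF k1(3) k(2) ys cong] by (simp only:)
    hence "(\<Sum>m<Q. c m * G n (b + i) (y * \<xi> ^ m)) =
        (\<Sum>m'<Q. c m' * G k (b + e * d (k - 1) * (w * m)) ((y * \<xi> ^ m') ^ 1))"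
      by (simp only: power_one_right)
    also have "\<dots> = (\<Sum>t<e. if t = 0 then h m else 0)"
      unfolding GP
    proof (intro sum.cong refl)
      fix t assume t: "t \<in> {..<e}"
      have "[1 * g ^ (b + e * d (k - 1) * (w * m) + t * d k) = r] (mod Q) \<longleftrightarrow>
          e * d (k - 1) dvd e * d (k - 1) * (w * m) + t * d k"
        using key[of "e * d (k - 1) * (w * m) + t * d k"] by (simp add: add.assoc)
      also have "\<dots> \<longleftrightarrow> e * d (k - 1) dvd t * d k" by (simp only: dvd_add_right_iff dvd_triv_left)
      also have "\<dots> \<longleftrightarrow> e dvd t * p"
        unfolding dk mult.assoc[symmetric] using d_pos[of "k - 1"] by simp
      also have "t * p = t * f * e + t" unfolding p_eq by (simp add: algebra_simps)
      also have "e dvd t * f * e + t \<longleftrightarrow> e dvd t" by simp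
      also have "\<dots> \<longleftrightarrow> t = 0" using t by (auto dest: dvd_imp_le)
      finally show "(if [1 * g ^ (b + e * d (k - 1) * (w * m) + t * d k) = r] (mod Q)
          then y ^ (1 * g ^ (b + e * d (k - 1) * (w * m) + t * d k)) else 0) = (if t = 0 then h m else 0)"
        by (simp add: h_def)
    qed
    also have "\<dots> = h m" using e_pos by simp
    also have "h m = h (i div d (k - 1))" using m d_pos[of "k - 1"] by simp
    finally show ?thesis using True by simp
  qed
  \<comment> \<open>\<open>M\<close> counts the multiples of \<open>d (k - 1)\<close>, 0 included,
    below \<open>d n div 2\<close>. There is an odd number of them below \<open>d n\<close>, whence
    the rounding up.\<close>
  define M where "M = (p ^ (n - (k - 1)) + 1) div 2"
  have "(\<Sum>m<M. h m) = 0"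
  proof -
    obtain D where D: "d (k - 1) = 2 * D" using even_d by blast
    have "D > 0" using d_pos[of "k - 1"] D by simp
    have "odd (p ^ (n - (k - 1)))" using odd_p by simp
    then obtain q where q: "p ^ (n - (k - 1)) = 2 * q + 1" by (rule oddE)
    have half: "d n div 2 = (2 * q + 1) * D" unfolding dn q D by simp
    have "m * d (k - 1) < d n div 2 \<longleftrightarrow> m < M" for m
    proof -
      have "m * d (k - 1) < d n div 2 \<longleftrightarrow> (2 * m) * D < (2 * q + 1) * D"
        unfolding half D by (simp only: mult_ac)
      also have "\<dots> \<longleftrightarrow> 2 * m < 2 * q + 1" using \<open>D > 0\<close> by (simp only: mult_less_cancel2 simp_thms)
      also have "\<dots> \<longleftrightarrow> m < M" unfolding M_def q by auto
      finally show ?thesis .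
    qed
    thus ?thesis using sum_over_multiples[OF d_pos[of "k - 1"], of "d n div 2" M h] sum0
      unfolding H by simp
  qed
  moreover obtain \<delta> where \<delta>: "\<delta> ^ p = 1" "\<delta> \<noteq> 1"
    "\<forall>m. y ^ (g ^ (b + e * d (k - 1) * ((1 + (e - 1) * f) * m))) = y ^ (g ^ b) * \<delta> ^ m"
    by (rule unity_root_power_shift[OF k y])
  hence "h m = y ^ (g ^ b) * \<delta> ^ m" for m by (simp only: h_def w_def)
  ultimately have "y ^ (g ^ b) * (\<Sum>m<M. \<delta> ^ m) = 0"
    by (simp only: sum_distrib_left)
  moreover have "y \<noteq> 0" using y(1) p_gt_2 by (intro notI) (simp add: power_0_left)
  ultimately have "(\<Sum>m<M. \<delta> ^ m) = 0" by simp
  hence "\<delta> ^ M = 1" using \<delta>(2) by (simp add: geometric_sum)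
  moreover have "\<delta> ^ (p ^ 1) = 1" "\<delta> ^ (p ^ (1 - 1)) \<noteq> 1" using \<delta> by simp_all
  ultimately have "p ^ 1 dvd M"
    using power_eq_one_iff_prime_power_dvd[OF prime_p order_refl, of \<delta> M] by blast
  moreover have "n - (k - 1) \<ge> 1" using k by simp
  ultimately show False using not_p_dvd_half_Suc_power[of "n - (k - 1)"] unfolding M_def by simp
qed

end

section \<open>Gauss periods modulo \<open>p\<close>\<close>

lemma sum_periodic:
  fixes h :: "nat \<Rightarrow> 'b :: comm_semiring_1"
  assumes "\<And>i. h (i + q) = h i"
  shows "(\<Sum>i<m * q + r. h i) = of_nat m * (\<Sum>i<q. h i) + (\<Sum>i<r. h i)"
proof -
  have split: "(\<Sum>i<q + s. h i) = (\<Sum>i<q. h i) + (\<Sum>i<s. h i)" for s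
  proof (induction s)
    case (Suc s)
    have "h (q + s) = h s" using assms[of s] by (simp only: add.commute)
    thus ?case using Suc.IH by (simp add: add.assoc)
  qed simp
  show ?thesis
  proof (induction m)
    case (Suc m)
    have "(\<Sum>i<Suc m * q + r. h i) = (\<Sum>i<q + (m * q + r). h i)" by (simp add: add_ac)
    thus ?case unfolding split Suc.IH by (simp add: algebra_simps)
  qed simp
qed

context gen_cyclotomic
begin

lemma G_1_cong:
  fixes z :: "'a :: field"
  assumes "z ^ p = 1" "[k = l] (mod f)"
  shows "G 1 k z = G 1 l z"
  using assms n_pos by (intro G_cong) (auto simp: dj_def)

text \<open>The terms are all the \<open>p\<close>-th roots of unity other than 1. Their sum is -1,
  which is 1 in characteristic 2.\<close>

lemma sum_primroot_powers:
  fixes z :: "'a :: field"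
  assumes "CHAR('a) = 2" "z ^ p = 1" "z \<noteq> 1"
  shows "(\<Sum>k<p - 1. z ^ (g ^ k)) = 1"
proof -
  have "residue_primroot p g"
    using ord_g[of 1] coprime_p_g n_pos p_gt_2 p_minus_1
    by (simp add: residue_primroot_def totient_prime[OF prime_p] dj_def)
  hence bij: "bij_betw (\<lambda>i. g ^ i mod p) {..<totient p} (totatives p)"
    using p_gt_2 by (intro residue_primroot_is_generator) auto
  have "(\<Sum>k<p - 1. z ^ (g ^ k)) = (\<Sum>k<totient p. z ^ (g ^ k mod p))"
    unfolding totient_prime[OF prime_p]
    by (intro sum.cong refl power_eq_if_cong[OF assms(2)]) (simp add: cong_def)
  also have "\<dots> = (\<Sum>u\<in>totatives p. z ^ u)"
    by (rule sum.reindex_bij_betw[OF bij])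
  also have "totatives p = {..<p} - {0}"
    using totatives_prime[OF prime_p] by auto
  also have "(\<Sum>u\<in>{..<p} - {0}. z ^ u) = (\<Sum>u<p. z ^ u) - 1"
    using p_gt_2 by (subst sum_diff1) auto
  also have "(\<Sum>u<p. z ^ u) = 0"
    using geometric_sum_root_of_unity[OF assms(1) odd_p assms(2)] assms(3) by simp
  also have "0 - 1 = (1 :: 'a)"
    using add_self_char_2[OF assms(1), of 1] by (simp only: diff_0 minus_unique)
  finally show ?thesis .
qed

text \<open>The numbers \<open>k + t * f\<close> run once through all exponents of \<open>g\<close>
  below \<open>p - 1\<close>; the shift by \<open>i\<close> is absorbed into the conjugate
  \<open>y\<close>.\<close>

lemma sum_G_1:
  fixes z :: "'a :: field"
  assumes "CHAR('a) = 2" "z ^ p = 1" "z \<noteq> 1"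
  shows "(\<Sum>k<f. G 1 (i + k) z) = 1"
proof -
  define y where "y = z ^ (g ^ i)"
  have y: "y ^ p = 1" unfolding y_def
    using assms(2) by (metis mult.commute power_mult power_one)
  have "z ^ (p ^ 1) = 1" "z ^ (p ^ (1 - 1)) \<noteq> 1" using assms by simp_all
  hence "y \<noteq> 1" unfolding y_def
    using power_eq_one_iff_prime_power_dvd[OF prime_p order_refl, of z] not_dvd_g_power[of i] by simp
  have "(\<Sum>k<f. G 1 (i + k) z) = (\<Sum>k<f. \<Sum>t<e. y ^ (g ^ (k + t * f)))"
    unfolding G_def y_def power_mult[symmetric] power_add[symmetric] dj_def by (simp add: add_ac)
  also have "\<dots> = (\<Sum>t<e. \<Sum>k<f. y ^ (g ^ (k + t * f)))" by (rule sum.swap)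
  also have "\<dots> = (\<Sum>t<e. \<Sum>k\<in>{t * f..<t * f + f}. y ^ (g ^ k))"
  proof (rule sum.cong[OF refl])
    fix t show "(\<Sum>k<f. y ^ (g ^ (k + t * f))) = (\<Sum>k\<in>{t * f..<t * f + f}. y ^ (g ^ k))"
      by (rule sum.reindex_bij_witness[of _ "\<lambda>k. k - t * f" "\<lambda>k. k + t * f"]) auto
  qed
  also have "\<dots> = (\<Sum>k<e * f. y ^ (g ^ k))" by (rule sum.nat_group)
  also have "e * f = p - 1" using p_minus_1 by simp
  also have "(\<Sum>k<p - 1. y ^ (g ^ k)) = 1"
    by (rule sum_primroot_powers[OF assms(1) y \<open>y \<noteq> 1\<close>])
  finally show ?thesis .
qed

text \<open>Levels below \<open>n\<close> see the argument 1 and contribute integers. At level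
  \<open>n\<close> the periods reduce to those of level 1, and
  \<open>d n div 2 = q * f + f div 2\<close> leaves \<open>q\<close> full cycles of sum 1 and one
  half cycle. The integer part gives \<open>\<kappa>\<close>, the same for all
  \<open>z\<close>.\<close>

lemma T_order_p:
  assumes char: "CHAR('a :: field) = 2"
  obtains \<kappa> :: "'a :: field" where "\<kappa>\<^sup>2 = \<kappa>"
    "\<forall>z. z ^ p = 1 \<longrightarrow> z \<noteq> 1 \<longrightarrow> T z = \<kappa> + (\<Sum>i<f div 2. G 1 (b + i) z)"
proof -
  have "odd (p ^ (n - 1))" using odd_p by simp
  then obtain q where q: "p ^ (n - 1) = 2 * q + 1" by (rule oddE)
  obtain f' where f': "f = 2 * f'" using even_f by blast
  have "d n = (2 * q + 1) * f" unfolding dj_def q by (rule refl)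
  hence dn: "d n div 2 = q * f + f div 2" unfolding f' by simp
  define K where "K = (\<Sum>j\<in>{1..<n}. (d j div 2) * e) + q"
  have "T z = of_nat K + (\<Sum>i<f div 2. G 1 (b + i) z)" if z: "z ^ p = 1" "z \<noteq> 1" for z :: 'a
  proof -
    have zp: "z ^ (p ^ l) = 1" if "l \<ge> 1" for l
    proof -
      have "p ^ l = p * p ^ (l - 1)" using that by (cases l) simp_all
      thus ?thesis using z(1) by (simp only: power_mult power_one)
    qed
    have "T z = (\<Sum>j\<in>{1..n}. \<Sum>i<d j div 2. G j (b + i) (z ^ (p ^ (n - j))))"
      by (rule T_eq[OF zp[OF n_pos]])
    also have "{1..n} = insert n {1..<n}" using n_pos by auto
    also have "(\<Sum>j\<in>insert n {1..<n}. \<Sum>i<d j div 2. G j (b + i) (z ^ (p ^ (n - j)))) =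
      (\<Sum>i<d n div 2. G n (b + i) z) + (\<Sum>j\<in>{1..<n}. \<Sum>i<d j div 2. G j (b + i) (z ^ (p ^ (n - j))))"
      by simp
    also have "(\<Sum>j\<in>{1..<n}. \<Sum>i<d j div 2. G j (b + i) (z ^ (p ^ (n - j)))) =
        (\<Sum>j\<in>{1..<n}. of_nat ((d j div 2) * e))"
    proof (intro sum.cong refl)
      fix j assume "j \<in> {1..<n}"
      hence "z ^ (p ^ (n - j)) = 1" by (intro zp) auto
      thus "(\<Sum>i<d j div 2. G j (b + i) (z ^ (p ^ (n - j)))) = of_nat ((d j div 2) * e)"
        by (simp add: G_def)
    qed
    also have "\<dots> = of_nat (\<Sum>j\<in>{1..<n}. (d j div 2) * e)" by simp
    also have "(\<Sum>i<d n div 2. G n (b + i) z) = (\<Sum>i<q * f + f div 2. G 1 (b + i) z)"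
      unfolding dn using z n_pos by (intro sum.cong refl G_level) auto
    also have "\<dots> = of_nat q * (\<Sum>i<f. G 1 (b + i) z) + (\<Sum>i<f div 2. G 1 (b + i) z)"
      by (intro sum_periodic G_1_cong z) (simp add: cong_def add.assoc[symmetric])
    also have "(\<Sum>i<f. G 1 (b + i) z) = 1" by (rule sum_G_1[OF char z])
    finally show ?thesis by (simp add: K_def add_ac)
  qed
  moreover have "(of_nat K :: 'a)\<^sup>2 = of_nat K"
  proof (cases "even K")
    case True
    hence "of_nat K = (0 :: 'a)" using char by (simp only: of_nat_eq_0_iff_char_dvd)
    thus ?thesis by simp
  next
    case False
    thus ?thesis by (simp add: of_nat_odd_char_2[OF char])
  qed
  ultimately show ?thesis by (intro that[of "of_nat K"]) auto
qed

end

subsection \<open>Roots of unity of order \<open>p\<close>\<close>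

locale gen_cyclotomic_root = gen_cyclotomic p e f n g b for p e f n g b :: nat +
  fixes \<gamma> :: "'a :: field"
  assumes char_2: "CHAR('a) = 2" and \<gamma>: "\<gamma> ^ p = 1" "\<gamma> \<noteq> 1"
begin

text \<open>Building \<open>b\<close> into the subscript removes it from the later formulas for
  \<open>E\<close>.\<close>

definition \<eta> :: "nat \<Rightarrow> 'a" where "\<eta> k = G 1 (b + k) \<gamma>"

definition E :: "nat \<Rightarrow> 'a" where "E i = T (\<gamma> ^ (g ^ i))"

lemma root_power_eq_iff: "\<gamma> ^ u = \<gamma> ^ v \<longleftrightarrow> [u = v] (mod p)"
  using power_eq_iff_cong_prime_power[OF prime_p order_refl, of \<gamma>] \<gamma> by simp

lemma root_conj: "(\<gamma> ^ (g ^ i)) ^ p = 1" "\<gamma> ^ (g ^ i) \<noteq> 1"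
proof -
  show "(\<gamma> ^ (g ^ i)) ^ p = 1"
    using \<gamma>(1) by (metis mult.commute power_mult power_one)
  have "\<not> [g ^ i = 0] (mod p)" using not_dvd_g_power[of i] by (simp only: cong_0_iff simp_thms)
  thus "\<gamma> ^ (g ^ i) \<noteq> 1" using root_power_eq_iff[of "g ^ i" 0] by simp
qed

lemma period_cong: "[k = l] (mod f) \<Longrightarrow> \<eta> k = \<eta> l"
  unfolding \<eta>_def by (intro G_1_cong \<gamma>(1) cong_add cong_refl)

lemma sum_periods: "(\<Sum>k<f. \<eta> (i + k)) = 1"
  using sum_G_1[OF char_2 \<gamma>, of "b + i"] unfolding \<eta>_def by (simp add: add.assoc)

lemma E_eq: obtains \<kappa> where "\<kappa>\<^sup>2 = \<kappa>" "\<forall>i. E i = \<kappa> + (\<Sum>k<f div 2. \<eta> (i + k))"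
proof -
  obtain \<kappa> :: 'a where \<kappa>: "\<kappa>\<^sup>2 = \<kappa>"
    "\<forall>z. z ^ p = 1 \<longrightarrow> z \<noteq> 1 \<longrightarrow> T z = \<kappa> + (\<Sum>i<f div 2. G 1 (b + i) z)"
    by (rule T_order_p[OF char_2])
  have "E i = \<kappa> + (\<Sum>k<f div 2. \<eta> (i + k))" for i
    unfolding E_def \<eta>_def \<kappa>(2)[rule_format, OF root_conj] G_power by (simp only: add_ac)
  thus ?thesis using that \<kappa>(1) by blast
qed

lemma E_cong: "[i = j] (mod f) \<Longrightarrow> E i = E j"
proof -
  assume ij: "[i = j] (mod f)"
  obtain \<kappa> where E: "\<forall>i. E i = \<kappa> + (\<Sum>k<f div 2. \<eta> (i + k))" by (rule E_eq)
  have "\<eta> (i + k) = \<eta> (j + k)" for k using ij by (intro period_cong cong_add cong_refl)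
  thus ?thesis unfolding E[rule_format] by (simp only:)
qed

lemma f_half: "f div 2 + f div 2 = f"
  using even_f by auto

text \<open>The windows of length \<open>f div 2\<close> starting at \<open>i\<close> and at
  \<open>i + f div 2\<close> form together a full cycle of sum 1.\<close>

lemma E_half: "E (i + f div 2) = E i + 1"
proof -
  obtain \<kappa> where E: "\<forall>i. E i = \<kappa> + (\<Sum>k<f div 2. \<eta> (i + k))" by (rule E_eq)
  have "(\<Sum>k<f div 2 + f div 2. \<eta> (i + k)) = (\<Sum>k<f div 2. \<eta> (i + k)) + (\<Sum>k<f div 2. \<eta> (i + f div 2 + k))"
  proof -
    have "(\<Sum>k<h + m. \<eta> (i + k)) = (\<Sum>k<h. \<eta> (i + k)) + (\<Sum>k<m. \<eta> (i + h + k))" for h m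
      by (induction m) (simp_all add: add.assoc)
    thus ?thesis .
  qed
  hence s: "(\<Sum>k<f div 2. \<eta> (i + k)) + (\<Sum>k<f div 2. \<eta> (i + f div 2 + k)) = 1"
    unfolding f_half sum_periods by (rule sym)
  have "E (i + f div 2) - (E i + 1) = (\<Sum>k<f div 2. \<eta> (i + f div 2 + k)) - (\<Sum>k<f div 2. \<eta> (i + k)) - 1"
    unfolding E[rule_format] by (simp add: algebra_simps)
  also have "\<dots> = - ((\<Sum>k<f div 2. \<eta> (i + k)) + (\<Sum>k<f div 2. \<eta> (i + k)))"
    unfolding s[symmetric] by (simp add: algebra_simps)
  also have "\<dots> = 0" unfolding add_self_char_2[OF char_2] by simp
  finally show ?thesis by simp
qed

text \<open>Moving the window by one place drops \<open>\<eta> i\<close> and gains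
  \<open>\<eta> (i + f div 2)\<close>; everything else occurs twice and cancels.\<close>

lemma E_Suc: "E (Suc i) + E i = \<eta> i + \<eta> (i + f div 2)"
proof -
  obtain \<kappa> where E: "\<forall>i. E i = \<kappa> + (\<Sum>k<f div 2. \<eta> (i + k))" by (rule E_eq)
  have "\<eta> i + (\<Sum>k<f div 2. \<eta> (Suc i + k)) = (\<Sum>k<Suc (f div 2). \<eta> (i + k))"
    by (simp add: sum.lessThan_Suc_shift del: sum.lessThan_Suc)
  also have "\<dots> = (\<Sum>k<f div 2. \<eta> (i + k)) + \<eta> (i + f div 2)" by simp
  finally have s: "(\<Sum>k<f div 2. \<eta> (Suc i + k)) = (\<Sum>k<f div 2. \<eta> (i + k)) + \<eta> (i + f div 2) - \<eta> i"
    by (simp add: algebra_simps)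
  have "E (Suc i) + E i - (\<eta> i + \<eta> (i + f div 2)) = (\<kappa> + \<kappa>) +
      ((\<Sum>k<f div 2. \<eta> (i + k)) + (\<Sum>k<f div 2. \<eta> (i + k))) - (\<eta> i + \<eta> i)"
    unfolding E[rule_format] s by (simp add: algebra_simps)
  also have "\<dots> = 0" unfolding add_self_char_2[OF char_2] by simp
  finally show ?thesis by simp
qed

lemma E_square:
  assumes "[g ^ a = 2] (mod p)"
  shows "E (i + a) = (E i)\<^sup>2"
proof -
  have "[g ^ i * g ^ a = g ^ i * 2] (mod p)" by (rule cong_mult[OF cong_refl assms])
  hence "\<gamma> ^ (g ^ (i + a)) = (\<gamma> ^ (g ^ i))\<^sup>2"
    unfolding power_add power_mult[symmetric] by (rule power_eq_if_cong[OF \<gamma>(1)])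
  thus ?thesis unfolding E_def by (simp only: T_square[OF char_2])
qed

text \<open>Otherwise \<open>Y (\<gamma> ^ m)\<close> would be 1 for \<open>m\<close> prime to
  \<open>p\<close> and 0 for \<open>m = 0\<close>, so its Fourier coefficient at the frequency
  \<open>g\<close> would be -1. But the frequencies in \<open>Y\<close> are powers of
  \<open>g\<close> with exponents divisible by \<open>f div 2\<close>, and \<open>g\<close> is not
  among them when \<open>f div 2 > 1\<close>.\<close>

lemma period_pairs_not_all_1:
  assumes "f div 2 > 1"
  shows "\<exists>k. \<eta> k + \<eta> (k + f div 2) \<noteq> 1"
proof (rule ccontr)
  assume "\<not> ?thesis"
  hence all: "\<eta> k + \<eta> (k + f div 2) = 1" for k by blast
  define Y where "Y z = G 1 0 z + G 1 (f div 2) z" for z :: 'a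
  define c where "c m = inverse (\<gamma> ^ g) ^ m" for m
  have Y1: "Y (\<gamma> ^ m) = 1" if "\<not> p dvd m" for m
  proof -
    have "coprime m p" using prime_imp_coprime[OF prime_p that] by (simp only: coprime_commute)
    then obtain l where l: "[g ^ l = m] (mod p ^ 1)"
      by (rule index_exists[OF order_refl n_pos])
    hence "[m = g ^ l] (mod p)" unfolding power_one_right by (rule cong_sym)
    hence "\<gamma> ^ m = \<gamma> ^ (g ^ l)" unfolding root_power_eq_iff .
    hence "Y (\<gamma> ^ m) = G 1 (0 + l) \<gamma> + G 1 (f div 2 + l) \<gamma>" unfolding Y_def by (simp only: G_power)
    \<comment> \<open>Adding \<open>(f - 1) * b\<close> is a subtraction of \<open>b\<close> modulo
      \<open>f\<close> within the naturals; it cancels the shift inside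
      \<open>\<eta>\<close>.\<close>
    also have "f * b = b + (f - 1) * b" using f_pos by (cases f) simp_all
    hence idx: "b + (l + ((f - 1) * b)) = 0 + l + f * b"
      "b + (l + ((f - 1) * b) + f div 2) = f div 2 + l + f * b" by (simp_all only: add_ac)
    have "G 1 (0 + l) \<gamma> = \<eta> (l + ((f - 1) * b))" "G 1 (f div 2 + l) \<gamma> = \<eta> (l + ((f - 1) * b) + f div 2)"
      unfolding \<eta>_def idx by (intro G_1_cong \<gamma>(1); simp add: cong_def)+
    hence "G 1 (0 + l) \<gamma> + G 1 (f div 2 + l) \<gamma> = 1" by (simp only: all)
    finally show ?thesis .
  qed
  have filt: "(\<Sum>m<p. c m * (1 * \<gamma> ^ m) ^ u) = (if [u = g] (mod p) then 1 else 0)" for u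
    unfolding c_def roots_of_unity_filter[OF char_2 odd_p \<gamma>(1)] root_power_eq_iff by simp
  have GP: "(\<Sum>m<p. c m * G 1 l (\<gamma> ^ m)) = 0" if "\<not> [l = 1] (mod f div 2)" for l
  proof -
    have "(\<Sum>m<p. c m * G 1 l (\<gamma> ^ m)) = (\<Sum>m<p. \<Sum>t<e. c m * (1 * \<gamma> ^ m) ^ (g ^ (l + t * d 1)))"
      unfolding G_def sum_distrib_left mult_1 by (rule refl)
    also have "\<dots> = (\<Sum>t<e. \<Sum>m<p. c m * (1 * \<gamma> ^ m) ^ (g ^ (l + t * d 1)))" by (rule sum.swap)
    also have "\<dots> = (\<Sum>t<e. 0)"
      unfolding filt
    proof (rule sum.cong[OF refl])
      fix t
      have "\<not> [g ^ (l + t * d 1) = g ^ 1] (mod p ^ 1)"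
      proof
        assume "[g ^ (l + t * d 1) = g ^ 1] (mod p ^ 1)"
        hence c1: "[l + t * d 1 = 1] (mod e * d 1)"
          using g_power_cong_iff[OF order_refl n_pos] by blast
        have "f = (f div 2) * 2" using even_f by simp
        hence "f div 2 dvd f" by (rule dvdI)
        hence dv: "f div 2 dvd d 1" by (simp add: dj_def)
        have c2: "[l + t * d 1 = 1] (mod f div 2)"
          by (rule cong_dvd_modulus_nat[OF c1 dvd_mult[OF dv]])
        have c3: "[l + t * d 1 = l + 0] (mod f div 2)"
          by (rule cong_add[OF cong_refl]) (simp only: cong_0_iff dvd_mult[OF dv])
        have "[l + 0 = 1] (mod f div 2)" by (rule cong_trans[OF cong_sym[OF c3] c2])
        hence "[l = 1] (mod f div 2)" by simp
        thus False using that by contradiction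
      qed
      thus "(if [g ^ (l + t * d 1) = g] (mod p) then 1 else 0) = (0 :: 'a)" by simp
    qed
    finally show ?thesis by simp
  qed
  have "(\<Sum>m<p. c m * Y (\<gamma> ^ m)) = 0"
  proof -
    have n1: "\<not> [0 = 1] (mod f div 2)" and n2: "\<not> [f div 2 = 1] (mod f div 2)"
      using assms by (simp_all add: cong_def)
    show ?thesis unfolding Y_def distrib_left sum.distrib GP[OF n1] GP[OF n2] by simp
  qed
  moreover have "(\<Sum>m<p. c m * Y (\<gamma> ^ m)) = (\<Sum>m<p. c m - (if m = 0 then 1 else 0))"
  proof (rule sum.cong[OF refl])
    fix m assume m: "m \<in> {..<p}"
    show "c m * Y (\<gamma> ^ m) = c m - (if m = 0 then 1 else 0)"
    proof (cases "m = 0")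
      case True
      have "Y 1 = of_nat e + of_nat e" unfolding Y_def G_def by simp
      hence "Y 1 = 0" by (simp only: add_self_char_2[OF char_2])
      thus ?thesis using True by (simp add: c_def)
    next
      case False
      hence "\<not> p dvd m" using m by (auto dest: dvd_imp_le)
      thus ?thesis using False Y1 by simp
    qed
  qed
  moreover have "\<not> [0 = g] (mod p)"
  proof
    assume "[0 = g] (mod p)"
    hence "p dvd g ^ 1" unfolding power_one_right cong_0_iff[symmetric] by (rule cong_sym)
    thus False using not_dvd_g_power by blast
  qed
  hence "(\<Sum>m<p. c m) = 0" using filt[of 0] by simp
  ultimately show False using p_gt_2 by (simp add: sum_subtractf)
qed

text \<open>By \<open>E_Suc\<close> the assumption gives \<open>Y (Suc k) = Y k\<close> for
  \<open>k\<close> of the parity of \<open>i\<close>, and the odd period \<open>h\<close> of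
  \<open>Y\<close> transfers this to the other parity. So \<open>Y\<close> is constant;
  \<open>h\<close> consecutive values sum to 1 with \<open>h\<close> odd, hence the constant is 1,
  against \<open>period_pairs_not_all_1\<close>.\<close>

lemma E_not_2_periodic:
  assumes "odd (f div 2)" "f div 2 > 1" "\<And>m. E (i + 2 * m) = E i"
  shows False
proof -
  define h where "h = f div 2"
  define Y where "Y k = \<eta> k + \<eta> (k + h)" for k
  have Yper: "Y (k + h) = Y k" for k
  proof -
    have "\<eta> (k + h + h) = \<eta> k" unfolding h_def add.assoc f_half by (rule period_cong) (simp add: cong_def)
    thus ?thesis unfolding Y_def by (simp only:) (rule add.commute)
  qed
  have step: "Y (Suc k) = Y k" if ki: "k \<ge> i" and ev: "even (k - i)" for k
  proof -
    obtain m where "k - i = 2 * m" using ev by (rule evenE)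
    hence k: "k = i + 2 * m" "Suc (Suc k) = i + 2 * Suc m" using ki by simp_all
    have "E (Suc (Suc k)) = E i" unfolding k(2) by (rule assms(3))
    moreover have "E k = E i" unfolding k(1) by (rule assms(3))
    ultimately have "E (Suc (Suc k)) + E k = 0" by (simp only: add_self_char_2[OF char_2])
    moreover have "Y (Suc k) + Y k = E (Suc (Suc k)) + E k + (E (Suc k) + E (Suc k))"
      unfolding Y_def h_def E_Suc[symmetric] by (simp only: add_ac)
    ultimately have "Y (Suc k) + Y k = 0" by (simp only: add_self_char_2[OF char_2] add_0_right)
    moreover have "Y k + Y k = 0" by (rule add_self_char_2[OF char_2])
    ultimately have "Y (Suc k) + Y k = Y k + Y k" by (simp only:)
    thus ?thesis by (simp only: add_right_cancel)
  qed
  have step': "Y (Suc k) = Y k" if "k \<ge> i" for k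
  proof (cases "even (k - i)")
    case True thus ?thesis using step that by blast
  next
    case False
    moreover have "k + h - i = (k - i) + h" using that by simp
    ultimately have "even (k + h - i)" using assms(1) unfolding h_def by (simp only: even_add)
    hence "Y (Suc (k + h)) = Y (k + h)" using that by (intro step) auto
    thus ?thesis using Yper[of k] Yper[of "Suc k"] by (simp only: add_Suc)
  qed
  have const: "Y (i + m) = Y i" for m
    by (induction m) (simp_all add: step')
  have "(\<Sum>k<h. Y (i + k)) = (\<Sum>k<h. \<eta> (i + k)) + (\<Sum>k<h. \<eta> (i + h + k))"
    unfolding Y_def sum.distrib by (simp only: add_ac)
  also have "\<dots> = (\<Sum>k<h + h. \<eta> (i + k))"
  proof -
    have "(\<Sum>k<h + m. \<eta> (i + k)) = (\<Sum>k<h. \<eta> (i + k)) + (\<Sum>k<m. \<eta> (i + h + k))" for m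
      by (induction m) (simp_all add: add.assoc)
    thus ?thesis by (simp only:)
  qed
  also have "\<dots> = 1" unfolding h_def f_half by (rule sum_periods)
  finally have "of_nat h * Y i = 1" by (simp add: const)
  hence "Y i = 1" using of_nat_odd_char_2[OF char_2 assms(1)] unfolding h_def by simp
  \<comment> \<open>Constancy is known only from \<open>i\<close> onwards; adding the multiple
    \<open>f * i\<close> of the period carries every \<open>k\<close> into that range.\<close>
  have "Y k = 1" for k
  proof -
    have per: "\<eta> l = \<eta> (l + f * i)" for l by (rule period_cong) (simp add: cong_def)
    have "k + f * i + h = k + h + f * i" by simp
    hence "Y k = Y (k + f * i)" unfolding Y_def using per[of k] per[of "k + h"] by (simp only:)
    also have "f * i = i + (f - 1) * i" using f_pos by (cases f) simp_all
    hence "k + f * i = i + (k + (f - 1) * i)" by (simp only: add_ac)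
    hence "Y (k + f * i) = Y i" using const[of "k + (f - 1) * i"] by (simp only:)
    finally show ?thesis using \<open>Y i = 1\<close> by simp
  qed
  thus False using period_pairs_not_all_1[OF assms(2)] unfolding Y_def h_def by blast
qed

end

subsection \<open>Linear complexity\<close>

text \<open>All roots of \<open>monom 1 (2 * q) - 1\<close> are double, so twice their number is the
  degree \<open>2 * q\<close>.\<close>

lemma card_roots_of_unity_char_2:
  assumes char: "CHAR('a :: alg_closed_field) = 2" and "odd q"
  shows "finite {x :: 'a. x ^ q = 1}" "card {x :: 'a. x ^ q = 1} = q"
proof -
  let ?P = "monom 1 (2 * q) - 1 :: 'a poly"
  have "q > 0" using \<open>odd q\<close> by (rule odd_pos)
  have deg: "degree ?P = 2 * q"
  proof -
    have "degree (monom (1 :: 'a) (2 * q) + (- 1)) = degree (monom (1 :: 'a) (2 * q))"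
      using \<open>q > 0\<close> by (intro degree_add_eq_left) (simp add: degree_monom_eq)
    thus ?thesis by (simp add: degree_monom_eq)
  qed
  have nz: "?P \<noteq> 0" using deg \<open>q > 0\<close> by (intro notI) simp
  have "poly ?P x = 0 \<longleftrightarrow> x ^ q = 1" for x
  proof -
    have "poly ?P x = 0 \<longleftrightarrow> order x ?P \<noteq> 0" using order_root[of ?P x] nz by blast
    thus ?thesis using order_power_minus_one_squared[OF char \<open>odd q\<close>, of x] by (simp only: split: if_splits) simp_all
  qed
  hence roots: "{x. poly ?P x = 0} = {x. x ^ q = 1}" by (rule Collect_cong)
  show fin: "finite {x :: 'a. x ^ q = 1}"
    by (rule poly_roots_finite[OF nz, unfolded roots])
  have "degree ?P = (\<Sum>x | x ^ q = 1. order x ?P)"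
    using roots by (intro degree_eq_sum_order nz fin) blast
  also have "\<dots> = (\<Sum>x \<in> {x :: 'a. x ^ q = 1}. 2)"
    using order_power_minus_one_squared[OF char \<open>odd q\<close>] by (intro sum.cong refl) simp
  finally have "2 * q = (\<Sum>x \<in> {x :: 'a. x ^ q = 1}. 2)" by (simp only: deg)
  thus "card {x :: 'a. x ^ q = 1} = q" by simp
qed

context gen_cyclotomic
begin

lemma primitive_root_exists:
  assumes char: "CHAR('a :: alg_closed_field) = 2"
  obtains \<gamma> :: "'a :: alg_closed_field" where "\<gamma> ^ p = 1" "\<gamma> \<noteq> 1"
proof -
  have "{x :: 'a. x ^ p = 1} \<noteq> {1}"
    using card_roots_of_unity_char_2(2)[OF char odd_p] p_gt_2 by (intro notI) simp
  moreover have "1 \<in> {x :: 'a. x ^ p = 1}" by simp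
  ultimately show ?thesis using that by blast
qed

lemma bij_betw_primitive_roots:
  fixes \<gamma> :: "'a :: alg_closed_field"
  assumes char: "CHAR('a) = 2" and \<gamma>: "\<gamma> ^ p = 1" "\<gamma> \<noteq> 1"
  shows "bij_betw (\<lambda>i. \<gamma> ^ (g ^ i)) {..<p - 1} {x. x ^ p = 1 \<and> x \<noteq> 1}"
proof -
  interpret gen_cyclotomic_root p e f n g b \<gamma> by unfold_locales (fact char \<gamma>)+
  have inj: "inj_on (\<lambda>i. \<gamma> ^ (g ^ i)) {..<p - 1}"
  proof (rule inj_onI)
    fix i j assume ij: "i \<in> {..<p - 1}" "j \<in> {..<p - 1}" "\<gamma> ^ (g ^ i) = \<gamma> ^ (g ^ j)"
    hence "[g ^ i = g ^ j] (mod p ^ 1)" by (simp only: root_power_eq_iff power_one_right)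
    hence "[i = j] (mod e * d 1)" using g_power_cong_iff[OF order_refl n_pos] by blast
    moreover have "e * d 1 = p - 1" by (simp add: dj_def p_minus_1)
    ultimately show "i = j" using ij by (simp add: cong_def)
  qed
  have eq: "{x :: 'a. x ^ p = 1 \<and> x \<noteq> 1} = {x. x ^ p = 1} - {1}" by blast
  have fin: "finite {x :: 'a. x ^ p = 1 \<and> x \<noteq> 1}" and "card {x :: 'a. x ^ p = 1 \<and> x \<noteq> 1} = p - 1"
    unfolding eq using card_roots_of_unity_char_2[OF char odd_p] by simp_all
  hence "card ((\<lambda>i. \<gamma> ^ (g ^ i)) ` {..<p - 1}) = card {x :: 'a. x ^ p = 1 \<and> x \<noteq> 1}"
    by (simp only: card_image[OF inj] card_lessThan)
  hence "(\<lambda>i. \<gamma> ^ (g ^ i)) ` {..<p - 1} = {x. x ^ p = 1 \<and> x \<noteq> 1}"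
    using root_conj fin by (intro card_subset_eq) auto
  thus ?thesis using inj unfolding bij_betw_def by blast
qed

lemma T_outside_F4_if_power_p_neq_1:
  fixes y :: "'a :: field"
  assumes "CHAR('a) = 2" "y ^ (p ^ n) = 1" "y ^ p \<noteq> 1"
  shows "T y ^ 4 \<noteq> T y"
proof -
  \<comment> \<open>For this least \<open>k\<close> the order of \<open>y\<close> is exactly
    \<open>p ^ k\<close>.\<close>
  define k where "k = (LEAST k. y ^ (p ^ k) = 1)"
  have k: "y ^ (p ^ k) = 1" unfolding k_def using assms(2) by (rule LeastI)
  have "k \<le> n" unfolding k_def using assms(2) by (rule Least_le)
  have "k \<noteq> 0" using k assms(3) by (intro notI) simp
  moreover have "k \<noteq> 1" using k assms(3) by (intro notI) simp
  ultimately have "2 \<le> k" by simp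
  hence "k - 1 < k" by simp
  hence "y ^ (p ^ (k - 1)) \<noteq> 1" unfolding k_def by (rule not_less_Least)
  thus ?thesis using T_outside_F4[OF assms(1) \<open>2 \<le> k\<close> \<open>k \<le> n\<close> k] by blast
qed

section \<open>The two sequence polynomials in terms of \<open>T\<close>\<close>

lemma sum_high_idx:
  fixes y :: "'a :: field"
  assumes "CHAR('a) = 2" "y ^ (p ^ n) = 1"
  shows "(\<Sum>x\<in>high_idx. y ^ res x) = T y + (if y = 1 then 0 else 1)"
proof -
  have "T y + (\<Sum>x\<in>high_idx. y ^ res x) = (\<Sum>x\<in>all_idx. y ^ res x)"
    unfolding T_def idx_split(1) by (rule sum.union_disjoint[symmetric]) (rule idx_split)+
  hence "T y + (\<Sum>x\<in>high_idx. y ^ res x) = (if y = 1 then 0 else 1)"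
    by (simp only: sum_all_idx[OF assms])
  hence "T y + (T y + (\<Sum>x\<in>high_idx. y ^ res x)) = T y + (if y = 1 then 0 else 1)"
    by (simp only:)
  thus ?thesis by (simp only: add.assoc[symmetric] add_self_char_2[OF assms(1)] add_0)
qed

lemma low_high_subset: "low_idx \<subseteq> all_idx" "high_idx \<subseteq> all_idx"
  using idx_split(1) by blast+

lemma poly_s:
  fixes y :: "'a :: field"
  assumes "CHAR('a) = 2" "y ^ (p ^ n) = 1"
  shows "poly (supp_poly low_idx low_idx) y = (T y)\<^sup>2 + T y + 1"
  using poly_supp_poly[OF assms low_high_subset(1) low_high_subset(1)]
  unfolding T_def[symmetric] by (simp only: add_ac)

lemma poly_st:
  fixes y :: "'a :: field"
  assumes "CHAR('a) = 2" "y ^ (p ^ n) = 1"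
  shows "poly (supp_poly low_idx high_idx) y = (T y)\<^sup>2 + T y + (if y = 1 then 1 else 0)"
proof -
  have "poly (supp_poly low_idx high_idx) y = 1 + T y + (T y + (if y = 1 then 0 else 1))\<^sup>2"
    using poly_supp_poly[OF assms low_high_subset]
    unfolding T_def[symmetric] sum_high_idx[OF assms] .
  also have "\<dots> = (T y)\<^sup>2 + T y + (if y = 1 then 1 else 0)"
  proof (cases "y = 1")
    case False
    have "1 + T y + (T y + 1)\<^sup>2 = (T y)\<^sup>2 + T y + (1 + 1)"
      unfolding square_add_one_char_2[OF assms(1)] by (simp only: add_ac)
    also have "(1 :: 'a) + 1 = 0" by (rule add_self_char_2[OF assms(1)])
    finally show ?thesis using False by simp
  qed (simp add: add_ac)
  finally show ?thesis .
qed

lemma T_one_F2: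
  assumes "CHAR('a :: field) = 2"
  shows "(T (1 :: 'a))\<^sup>2 + T 1 + 1 = 1"
proof -
  have "(T (1 :: 'a))\<^sup>2 = T 1" using T_square[OF assms, of 1] by simp
  thus ?thesis by (simp only: add_self_char_2[OF assms] add_0)
qed

text \<open>By \<open>nz\<close> only the roots of order \<open>p\<close> contribute, and these are
  enumerated by the powers of \<open>g\<close>. As roots of unity are nonzero, the sum over
  \<open>A\<close> decides whether the derivative vanishes.\<close>

lemma degree_gcd_supp_poly:
  fixes \<gamma> :: "'a :: {alg_closed_field, field_gcd}"
  assumes char: "CHAR('a) = 2" and \<gamma>: "\<gamma> ^ p = 1" "\<gamma> \<noteq> 1"
    and AB: "A \<subseteq> all_idx" "B \<subseteq> all_idx"
    and nz: "\<And>y :: 'a. y ^ (p ^ n) = 1 \<Longrightarrow> y ^ p \<noteq> 1 \<or> y = 1 \<Longrightarrow> poly (supp_poly A B) y \<noteq> 0"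
  shows "degree (gcd (monom 1 (2 * p ^ n) - 1) (supp_poly A B :: 'a poly)) =
    (\<Sum>i<p - 1. if poly (supp_poly A B) (\<gamma> ^ (g ^ i)) \<noteq> 0 then 0
      else if (\<Sum>x\<in>A. (\<gamma> ^ (g ^ i)) ^ res x) \<noteq> 0 then 1 else 2)"
proof -
  let ?S = "supp_poly A B :: 'a poly"
  define wt where "wt y = (if poly ?S y \<noteq> 0 then 0
      else if (\<Sum>x\<in>A. y ^ res x) \<noteq> 0 then 1 else (2 :: nat))" for y
  have odd: "odd (p ^ n)" using odd_p by simp
  have "poly ?S 1 \<noteq> 0" by (rule nz) auto
  hence "?S \<noteq> 0" by (intro notI) simp
  have pn: "p ^ n = p * p ^ (n - 1)" using n_pos by (cases n) simp_all
  have "degree (gcd (monom 1 (2 * p ^ n) - 1) ?S) = (\<Sum>x | x ^ (p ^ n) = 1.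
      if poly ?S x \<noteq> 0 then 0 else if poly (pderiv ?S) x \<noteq> 0 then 1 else 2)"
    by (rule degree_gcd_power_minus_one_squared[OF char odd \<open>?S \<noteq> 0\<close>])
  also have "\<dots> = (\<Sum>x | x ^ (p ^ n) = 1. wt x)"
  proof (rule sum.cong[OF refl])
    fix x :: 'a assume "x \<in> {x. x ^ (p ^ n) = 1}"
    hence x: "x ^ (p ^ n) = 1" by simp
    have "x \<noteq> 0" using x p_gt_2 by (intro notI) (simp add: power_0_left)
    moreover have "x * poly (pderiv ?S) x = (\<Sum>i\<in>A. x ^ res i)"
      by (rule pderiv_supp_poly[OF char x AB])
    ultimately have "poly (pderiv ?S) x \<noteq> 0 \<longleftrightarrow> (\<Sum>i\<in>A. x ^ res i) \<noteq> 0"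
      by (simp flip: \<open>x * poly (pderiv ?S) x = (\<Sum>i\<in>A. x ^ res i)\<close>)
    thus "(if poly ?S x \<noteq> 0 then 0 else if poly (pderiv ?S) x \<noteq> 0 then 1 else 2) = wt x"
      unfolding wt_def by (simp only:)
  qed
  also have "\<dots> = (\<Sum>x \<in> {x. x ^ p = 1 \<and> x \<noteq> 1}. wt x)"
  proof (rule sum.mono_neutral_right)
    show "finite {x :: 'a. x ^ (p ^ n) = 1}"
      by (rule card_roots_of_unity_char_2(1)[OF char odd])
    show "{x :: 'a. x ^ p = 1 \<and> x \<noteq> 1} \<subseteq> {x. x ^ (p ^ n) = 1}"
      unfolding pn power_mult by auto
    show "\<forall>x\<in>{x. x ^ (p ^ n) = 1} - {x. x ^ p = 1 \<and> x \<noteq> 1}. wt x = 0"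
    proof
      fix x :: 'a assume "x \<in> {x. x ^ (p ^ n) = 1} - {x. x ^ p = 1 \<and> x \<noteq> 1}"
      hence "poly ?S x \<noteq> 0" by (intro nz) auto
      thus "wt x = 0" unfolding wt_def by simp
    qed
  qed
  also have "\<dots> = (\<Sum>i<p - 1. wt (\<gamma> ^ (g ^ i)))"
    by (rule sum.reindex_bij_betw[OF bij_betw_primitive_roots[OF char \<gamma>], symmetric])
  finally show ?thesis unfolding wt_def .
qed

lemma no_root_s:
  fixes y :: "'a :: field"
  assumes char: "CHAR('a) = 2" and y: "y ^ (p ^ n) = 1" "y ^ p \<noteq> 1 \<or> y = 1"
  shows "poly (supp_poly low_idx low_idx) y \<noteq> 0"
proof (cases "y = 1")
  case True
  thus ?thesis using poly_s[OF char y(1)] T_one_F2[OF char] by simp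
next
  case False
  hence "T y ^ 4 \<noteq> T y" using T_outside_F4_if_power_p_neq_1[OF char y(1)] y(2) by blast
  moreover have "T y ^ 4 = T y" if "(T y)\<^sup>2 + T y + 1 = 0"
  proof -
    have "T y ^ 4 = ((T y)\<^sup>2)\<^sup>2" by (simp flip: power_mult)
    thus ?thesis by (simp only: F4_element_square(2)[OF char that])
  qed
  ultimately show ?thesis unfolding poly_s[OF char y(1)] by blast
qed

lemma no_root_st:
  fixes y :: "'a :: field"
  assumes char: "CHAR('a) = 2" and y: "y ^ (p ^ n) = 1" "y ^ p \<noteq> 1 \<or> y = 1"
  shows "poly (supp_poly low_idx high_idx) y \<noteq> 0"
proof (cases "y = 1")
  case True
  thus ?thesis using poly_st[OF char y(1)] T_one_F2[OF char] by simp
next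
  case False
  hence "T y ^ 4 \<noteq> T y" using T_outside_F4_if_power_p_neq_1[OF char y(1)] y(2) by blast
  moreover have "T y ^ 4 = T y" if "(T y)\<^sup>2 + T y = 0"
  proof -
    have "(T y)\<^sup>2 + T y + T y = (T y)\<^sup>2"
      by (simp only: add.assoc add_self_char_2[OF char] add_0_right)
    hence sq: "(T y)\<^sup>2 = T y" using that by simp
    have "T y ^ 4 = ((T y)\<^sup>2)\<^sup>2" by (simp flip: power_mult)
    thus ?thesis by (simp only: sq)
  qed
  ultimately show ?thesis unfolding poly_st[OF char y(1)] using False by auto
qed

lemma lin_comp_seq_of:
  assumes "A \<subseteq> all_idx" "B \<subseteq> all_idx"
  shows "lin_comp (2 * p ^ n) (seq_of (2 * p ^ n) Zs (insert 0 (oddr ` A \<union> evenr ` B))) =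
    2 * p ^ n - degree (gcd (monom 1 (2 * p ^ n) - 1) (supp_poly A B :: bool mod_ring alg_closure poly))"
proof -
  have "map_poly to_ac (monom 1 (2 * p ^ n) - 1 :: bool mod_ring poly) = monom 1 (2 * p ^ n) - 1"
    by (rule poly_eqI) (simp add: coeff_map_poly)
  thus ?thesis
    unfolding lin_comp_def by (subst degree_gcd_to_ac) (simp only: map_poly_seq_of[OF assms])
qed

end

context gen_cyclotomic_root
begin

lemma root_conj_pn: "(\<gamma> ^ (g ^ i)) ^ (p ^ n) = 1"
proof -
  have "p ^ n = p * p ^ (n - 1)" using n_pos by (cases n) simp_all
  thus ?thesis by (simp only: power_mult root_conj(1) power_one)
qed

end

section \<open>Linear complexity as a count of values of \<open>E\<close>\<close>

lemma char_bool_mod_ring_alg_closure: "CHAR(bool mod_ring alg_closure) = 2"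
  by simp

text \<open>At a root \<open>E i\<close> cannot be 0, as the quadratic would then be 1. So all roots
  are simple and the degree of the gcd is a plain count.\<close>

lemma lin_comp_s:
  fixes \<gamma> :: "bool mod_ring alg_closure"
  assumes "gen_cyclotomic_root p e f n g \<gamma>"
  shows "lin_comp (2 * p ^ n) (s_seq p e f n g b) = 2 * p ^ n -
    card {i. i < p - 1 \<and> (gen_cyclotomic_root.E p e f n g b \<gamma> i)\<^sup>2 + gen_cyclotomic_root.E p e f n g b \<gamma> i + 1 = 0}"
proof -
  interpret gen_cyclotomic_root p e f n g b \<gamma> by (rule assms)
  let ?wt = "\<lambda>i. if poly (supp_poly low_idx low_idx) (\<gamma> ^ (g ^ i)) \<noteq> 0 then 0
      else if (\<Sum>x\<in>low_idx. (\<gamma> ^ (g ^ i)) ^ res x) \<noteq> 0 then 1 else (2 :: nat)"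
  have "lin_comp (2 * p ^ n) (s_seq p e f n g b) = 2 * p ^ n - (\<Sum>i<p - 1. ?wt i)"
    unfolding s_seq_def C1_eq lin_comp_seq_of[OF low_high_subset(1) low_high_subset(1)]
    by (subst degree_gcd_supp_poly[OF char_2 \<gamma> low_high_subset(1) low_high_subset(1)])
      (rule no_root_s[OF char_2], assumption+, rule refl)
  also have "(\<Sum>i<p - 1. ?wt i) = (\<Sum>i<p - 1. if (E i)\<^sup>2 + E i + 1 = 0 then 1 else 0)"
  proof (rule sum.cong[OF refl])
    fix i
    have "E i \<noteq> 0" if "(E i)\<^sup>2 + E i + 1 = 0" using that by (intro notI) simp
    thus "?wt i = (if (E i)\<^sup>2 + E i + 1 = 0 then 1 else 0)"
      unfolding poly_s[OF char_2 root_conj_pn] T_def[symmetric] E_def[symmetric] by simp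
  qed
  also have "\<dots> = card {i \<in> {..<p - 1}. (E i)\<^sup>2 + E i + 1 = 0}"
    by (simp only: sum.inter_filter[symmetric] finite_lessThan card_eq_sum)
  finally show ?thesis by simp
qed

text \<open>The polynomial takes the value \<open>E i * (E i + 1)\<close>, and \<open>E i\<close>
  also decides whether the derivative vanishes: 0 means a double root, 1 a simple one.\<close>

lemma lin_comp_st:
  fixes \<gamma> :: "bool mod_ring alg_closure"
  assumes "gen_cyclotomic_root p e f n g \<gamma>"
  shows "lin_comp (2 * p ^ n) (st_seq p e f n g b) = 2 * p ^ n -
    (\<Sum>i<p - 1. if gen_cyclotomic_root.E p e f n g b \<gamma> i = 0 then 2
      else if gen_cyclotomic_root.E p e f n g b \<gamma> i = 1 then 1 else 0)"
proof -
  interpret gen_cyclotomic_root p e f n g b \<gamma> by (rule assms)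
  let ?wt = "\<lambda>i. if poly (supp_poly low_idx high_idx) (\<gamma> ^ (g ^ i)) \<noteq> 0 then 0
      else if (\<Sum>x\<in>low_idx. (\<gamma> ^ (g ^ i)) ^ res x) \<noteq> 0 then 1 else (2 :: nat)"
  have "lin_comp (2 * p ^ n) (st_seq p e f n g b) = 2 * p ^ n - (\<Sum>i<p - 1. ?wt i)"
    unfolding st_seq_def C1t_eq lin_comp_seq_of[OF low_high_subset]
    by (subst degree_gcd_supp_poly[OF char_2 \<gamma> low_high_subset])
      (rule no_root_st[OF char_2], assumption+, rule refl)
  also have "(\<Sum>i<p - 1. ?wt i) = (\<Sum>i<p - 1. if E i = 0 then 2 else if E i = 1 then 1 else 0)"
  proof (rule sum.cong[OF refl])
    fix i
    have "(E i)\<^sup>2 + E i = E i * (E i + 1)" by (simp add: power2_eq_square distrib_left)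
    moreover have "E i + 1 = 0 \<longleftrightarrow> E i = 1"
      using add_self_char_2[OF char_2, of 1] by (metis add_right_cancel)
    ultimately have "(E i)\<^sup>2 + E i = 0 \<longleftrightarrow> E i = 0 \<or> E i = 1" by simp
    thus "?wt i = (if E i = 0 then 2 else if E i = 1 then 1 else 0)"
      unfolding poly_st[OF char_2 root_conj_pn] T_def[symmetric] E_def[symmetric]
      using root_conj(2)[of i] by simp
  qed
  finally show ?thesis .
qed

section \<open>The index of 2 and the action of squaring on \<open>E\<close>\<close>

context gen_cyclotomic
begin

text \<open>The order of \<open>g ^ a\<close> modulo \<open>p\<close> is
  \<open>(p - 1) div gcd a (p - 1)\<close>. Since \<open>f\<close> divides \<open>p - 1\<close>, the
  further gcd with \<open>f\<close> is \<open>gcd a f\<close>.\<close>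

lemma index_of_2:
  obtains a where "[g ^ a = 2] (mod p)" "ord p 2 * gcd a (p - 1) = p - 1"
    "gcd ((p - 1) div ord p 2) f = gcd a f" "(p - 1) div ord p 2 = gcd a (p - 1)"
    "ord p 2 > 0"
proof -
  have "coprime 2 p" using odd_p by simp
  then obtain a where "[g ^ a = 2] (mod p ^ 1)" by (rule index_exists[OF order_refl n_pos])
  hence a: "[g ^ a = 2] (mod p)" by simp
  have "ord p g = p - 1" using ord_g[OF order_refl n_pos] by (simp add: dj_def p_minus_1)
  hence "ord p (g ^ a) = (p - 1) div gcd a (p - 1)"
    using ord_power[OF coprime_p_g, of a] by simp
  moreover have "ord p (g ^ a) = ord p 2" by (rule ord_cong[OF a])
  ultimately have o: "ord p 2 = (p - 1) div gcd a (p - 1)" by simp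
  hence m: "ord p 2 * gcd a (p - 1) = p - 1" by simp
  have "p - 1 > 0" using p_gt_2 by simp
  hence pos: "ord p 2 > 0" using m by (intro gr0I) simp
  have q: "(p - 1) div ord p 2 = gcd a (p - 1)"
    using m pos by (metis nonzero_mult_div_cancel_left less_irrefl)
  have "gcd (p - 1) f = f" unfolding p_minus_1 by simp
  hence v: "gcd ((p - 1) div ord p 2) f = gcd a f" unfolding q gcd.assoc by (simp only:)
  show ?thesis by (rule that[OF a m v q pos])
qed

end

context gen_cyclotomic_root
begin

text \<open>Advancing the argument of \<open>E\<close> by \<open>a\<close> is a squaring, so a
  property stable under squaring spreads to all multiples of \<open>a\<close> modulo
  \<open>f\<close>.\<close>

lemma E_orbit:
  assumes "[g ^ a = 2] (mod p)" "\<And>x. Q x \<Longrightarrow> Q (x\<^sup>2)" "Q (E i)" "[a * z = c] (mod f)"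
  shows "Q (E (i + c))"
proof -
  have "Q (E (i + a * z))"
  proof (induction z)
    case (Suc z)
    hence "Q (E ((i + a * z) + a))" unfolding E_square[OF assms(1)] by (rule assms(2))
    thus ?case by (simp add: add_ac)
  qed (simp add: assms(3))
  moreover have "E (i + a * z) = E (i + c)" using assms(4) by (intro E_cong cong_add cong_refl)
  ultimately show ?thesis by (simp only:)
qed

text \<open>By Bezout \<open>h = gcd a (p - 1)\<close> is a multiple of \<open>a\<close> modulo
  \<open>p - 1\<close>, so the truth of \<open>Q (E i)\<close> has period \<open>h\<close> in
  \<open>i\<close>. The range consists of \<open>k\<close> such periods, and \<open>r\<close> is the
  count within one.\<close>

lemma card_E_multiple_of_ord:
  assumes a: "[g ^ a = 2] (mod p)" and "k * gcd a (p - 1) = p - 1"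
    and Q: "\<And>x. Q x \<Longrightarrow> Q (x\<^sup>2)"
  obtains r where "r \<le> gcd a (p - 1)" "card {i. i < p - 1 \<and> Q (E i)} = r * k"
proof -
  define h where "h = gcd a (p - 1)"
  obtain z where "[a * z = h] (mod p - 1)" unfolding h_def using cong_solve_nat by blast
  moreover have "f dvd p - 1" unfolding p_minus_1 by simp
  ultimately have z: "[a * z = h] (mod f)" by (rule cong_dvd_modulus_nat)
  have step: "Q (E (i + h))" if "Q (E i)" for i by (rule E_orbit[where Q = Q, OF a Q that z])
  have step': "Q (E (i + m * h))" if Qi: "Q (E i)" for i m
  proof (induction m)
    case (Suc m)
    thus ?case using step[of "i + m * h"] by (simp add: add_ac)
  qed (simp add: Qi)
  have "k > 0" using assms(2) p_gt_2 by (intro gr0I) simp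
  have per: "Q (E (i + h)) \<longleftrightarrow> Q (E i)" for i
  proof
    \<comment> \<open>For the converse, \<open>k - 1\<close> further steps of length
      \<open>h\<close> complete a full turn \<open>p - 1\<close>, which is a multiple of
      \<open>f\<close>.\<close>
    assume "Q (E (i + h))"
    hence "Q (E (i + h + (k - 1) * h))" by (rule step')
    also have "h + (k - 1) * h = p - 1"
      using \<open>k > 0\<close> assms(2) unfolding h_def by (cases k) simp_all
    hence "i + h + (k - 1) * h = i + (p - 1)" by simp
    also have "E (i + (p - 1)) = E i"
      unfolding p_minus_1 by (rule E_cong) (simp add: cong_def)
    finally show "Q (E i)" .
  qed (rule step)
  define u where "u i = (if Q (E i) then 1 else 0 :: nat)" for i
  have "u (i + h) = u i" for i unfolding u_def per by (rule refl)
  hence "(\<Sum>i<k * h + 0. u i) = of_nat k * (\<Sum>i<h. u i) + (\<Sum>i<0. u i)" by (rule sum_periodic)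
  hence s: "(\<Sum>i<p - 1. u i) = k * (\<Sum>i<h. u i)" using assms(2) unfolding h_def by simp
  have "card {i. i < m \<and> Q (E i)} = (\<Sum>i<m. u i)" for m
  proof -
    have "(\<Sum>i<m. u i) = card {i \<in> {..<m}. Q (E i)}"
      unfolding u_def by (simp only: sum.inter_filter[symmetric] finite_lessThan card_eq_sum)
    thus ?thesis by simp
  qed
  moreover have "(\<Sum>i<h. u i) \<le> (\<Sum>i<h. 1)" unfolding u_def by (intro sum_mono) simp
  ultimately show ?thesis using s by (intro that[of "\<Sum>i<h. u i"]) (simp_all add: h_def mult.commute)
qed

lemma sum_E_halves:
  fixes u :: "'a \<Rightarrow> nat"
  shows "(\<Sum>i<p - 1. u (E i)) = e * (\<Sum>i<f div 2. u (E i) + u (E i + 1))"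
proof -
  have "(\<Sum>i<e * f + 0. u (E i)) = of_nat e * (\<Sum>i<f. u (E i)) + (\<Sum>i<0. u (E i))"
  proof (rule sum_periodic)
    fix i show "u (E (i + f)) = u (E i)"
      by (rule arg_cong[of _ _ u], rule E_cong) (simp add: cong_def)
  qed
  hence "(\<Sum>i<p - 1. u (E i)) = e * (\<Sum>i<f. u (E i))" unfolding p_minus_1 by simp
  also have "(\<Sum>i<f. u (E i)) = (\<Sum>i<f div 2 + f div 2. u (E i))" by (simp only: f_half)
  also have "\<dots> = (\<Sum>i<f div 2. u (E i)) + (\<Sum>i<f div 2. u (E (i + f div 2)))"
  proof -
    have "(\<Sum>i<h + m. u (E i)) = (\<Sum>i<h. u (E i)) + (\<Sum>i<m. u (E (i + h)))" for h m
      by (induction m) (simp_all add: add_ac)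
    thus ?thesis .
  qed
  finally show ?thesis by (simp only: E_half sum.distrib)
qed

lemma E_half_neq: "E (i + f div 2) \<noteq> E i"
  unfolding E_half by simp

text \<open>Two squarings fix an element of F_4, so \<open>E\<close> would return to
  \<open>E i\<close> along steps of \<open>2 * v\<close>, against \<open>E_half\<close> if
  \<open>2 * v\<close> divides \<open>f div 2\<close>. For \<open>v = 1\<close> there remains an odd
  \<open>f div 2 > 1\<close>, settled by \<open>E_not_2_periodic\<close>; for \<open>v = f\<close>
  squaring fixes \<open>E i\<close>, yet outside F_2 it adds 1.\<close>

lemma no_E_in_F4:
  assumes a: "[g ^ a = 2] (mod p)" and v: "v = gcd a f"
    and "v \<noteq> f div 2" "v = 1 \<or> 2 * v dvd f div 2 \<or> f = v"
  shows "(E i)\<^sup>2 + E i + 1 \<noteq> 0"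
proof
  assume F4: "(E i)\<^sup>2 + E i + 1 = 0"
  have sq: "(E i)\<^sup>2 = E i + 1" by (rule F4_element_square(1)[OF char_2 F4])
  have "E (j + 2 * a) = E i" if "E j = E i" for j
  proof -
    have "E (j + 2 * a) = (E (j + a))\<^sup>2" using E_square[OF a, of "j + a"] by (simp add: add_ac mult_2)
    thus ?thesis unfolding E_square[OF a] that by (simp only: F4_element_square(2)[OF char_2 F4])
  qed
  hence step: "E (i + 2 * a * z) = E i" for z
  proof (induction z)
    case (Suc z)
    hence "E (i + 2 * a * z + 2 * a) = E i" by blast
    thus ?case by (simp add: add_ac)
  qed simp
  obtain z where z: "[a * z = v] (mod f)" unfolding v using cong_solve_nat by blast
  have per: "E (i + 2 * v * m) = E i" for m
  proof -
    have "[2 * m * (a * z) = 2 * m * v] (mod f)" by (rule cong_mult[OF cong_refl z])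
    hence "[2 * a * (z * m) = 2 * v * m] (mod f)" by (simp only: mult_ac)
    hence "E (i + 2 * a * (z * m)) = E (i + 2 * v * m)" by (intro E_cong cong_add cong_refl)
    thus ?thesis using step by (simp only:)
  qed
  have dvd: False if dv: "2 * v dvd f div 2"
  proof -
    obtain m where "f div 2 = 2 * v * m" using dv by blast
    hence "E (i + f div 2) = E i" using per[of m] by (simp only:)
    thus False using E_half_neq by contradiction
  qed
  have "2 * v dvd f div 2" if "v = 1" "even (f div 2)" using that(2) unfolding that(1) by (simp only: mult_1_right)
  then consider "v = 1" "odd (f div 2)" | "2 * v dvd f div 2" | "f = v" using assms(4) by blast
  thus False
  proof cases
    case 1
    have "f div 2 > 0" using f_half f_pos by (intro gr0I) simp
    hence "f div 2 > 1" using assms(3) 1(1) by simp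
    thus False using per 1 by (intro E_not_2_periodic[of i]) simp_all
  next
    case 3
    hence "f dvd a" unfolding v by (metis gcd_dvd1)
    hence "[a = 0] (mod f)" by (simp only: cong_0_iff)
    hence "[i + a = i + 0] (mod f)" by (rule cong_add[OF cong_refl])
    hence "E (i + a) = E i" by (metis E_cong add_0_right)
    thus False using sq unfolding E_square[OF a] by simp
  qed (rule dvd)
qed

text \<open>Squaring now fixes \<open>E i\<close>, so \<open>E\<close> returns to it along steps of
  \<open>v\<close>. This contradicts \<open>E_half\<close> if \<open>v\<close> divides
  \<open>f div 2\<close>, and otherwise \<open>E_not_2_periodic\<close>, where
  \<open>v \<noteq> f\<close> rules out \<open>f div 2 = 1\<close>.\<close>

lemma no_E_in_F2:
  assumes a: "[g ^ a = 2] (mod p)" and v: "v = gcd a f"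
    and "v dvd f div 2 \<or> v = 2 \<and> v \<noteq> f"
  shows "(E i)\<^sup>2 \<noteq> E i"
proof
  assume sq: "(E i)\<^sup>2 = E i"
  obtain z where z: "[a * z = v] (mod f)" unfolding v using cong_solve_nat by blast
  have per: "E (i + v * m) = E i" for m
  proof -
    have "[a * z * m = v * m] (mod f)" by (rule cong_mult[OF z cong_refl])
    hence "[a * (z * m) = v * m] (mod f)" by (simp only: mult.assoc)
    thus ?thesis using sq by (intro E_orbit[where Q = "\<lambda>x. x = E i", OF a]) auto
  qed
  have dvd: False if dv: "v dvd f div 2"
  proof -
    obtain m where "f div 2 = v * m" using dv by blast
    hence "E (i + f div 2) = E i" using per[of m] by (simp only:)
    thus False using E_half_neq by contradiction
  qed
  have "v dvd f div 2" if "v = 2" "even (f div 2)" unfolding that(1) by (rule that(2))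
  then consider "v = 2" "odd (f div 2)" "v \<noteq> f" | "v dvd f div 2" using assms(3) by blast
  thus False
  proof cases
    case 1
    have "f div 2 > 0" using f_half f_pos by (intro gr0I) simp
    moreover have "f div 2 \<noteq> 1" using f_half 1 by (intro notI) simp
    ultimately have "f div 2 > 1" by simp
    thus False using per 1 by (intro E_not_2_periodic[of i]) simp_all
  qed (rule dvd)
qed

text \<open>Here \<open>a\<close> is an odd multiple of \<open>f div 2\<close>, hence congruent to
  it modulo \<open>f\<close>, and squaring acts on \<open>E\<close> as in
  \<open>E_half\<close>.\<close>

lemma all_E_in_F4:
  assumes a: "[g ^ a = 2] (mod p)" and v: "gcd a f = f div 2"
  shows "(E i)\<^sup>2 + E i + 1 = 0"
proof -
  define h where "h = f div 2"
  have f: "f = h * 2" unfolding h_def using even_f by simp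
  have "h > 0" using f f_pos by (intro gr0I) simp
  have "h dvd a" using v unfolding h_def by (metis gcd_dvd1)
  then obtain c where c: "a = h * c" by blast
  have "gcd a f = h * gcd c 2" unfolding c f by (simp add: gcd_mult_distrib_nat)
  hence "gcd c 2 = 1" using v \<open>h > 0\<close> unfolding h_def by simp
  have "odd c"
  proof
    assume "even c"
    hence "2 dvd gcd c 2" by simp
    thus False unfolding \<open>gcd c 2 = 1\<close> by simp
  qed
  then obtain m where "c = 2 * m + 1" by (rule oddE)
  hence "a = h + f * m" unfolding c f by (simp add: algebra_simps)
  hence "[i + a = i + h] (mod f)" by (simp add: cong_def add.assoc[symmetric])
  hence "E (i + a) = E i + 1" using E_cong E_half unfolding h_def by metis
  hence "(E i)\<^sup>2 = E i + 1" unfolding E_square[OF a] .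
  hence "(E i)\<^sup>2 + E i + 1 = (E i + 1) + (E i + 1)" by (simp only: add.assoc)
  thus ?thesis by (simp only: add_self_char_2[OF char_2])
qed

lemma all_E_in_F2:
  assumes a: "[g ^ a = 2] (mod p)" and v: "gcd a f = f"
  shows "(E i)\<^sup>2 = E i"
proof -
  have "f dvd a" using v by (metis gcd_dvd1)
  hence "[a = 0] (mod f)" by (simp only: cong_0_iff)
  hence "[i + a = i + 0] (mod f)" by (rule cong_add[OF cong_refl])
  hence "E (i + a) = E (i + 0)" by (rule E_cong)
  thus ?thesis unfolding E_square[OF a] by simp
qed

lemma E_in_F2_iff: "(E i)\<^sup>2 = E i \<longleftrightarrow> E i = 0 \<or> E i = 1"
  by (auto simp: power2_eq_square)

text \<open>Shifting the index by \<open>f div 2\<close> exchanges the values 0 and 1, so the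
  weights 2 and 1 occur equally often and average to 3/2. The factor 2 avoids a division.\<close>

lemma sum_weights_F2:
  "2 * (\<Sum>i<p - 1. if E i = 0 then 2 else if E i = 1 then 1 else 0 :: nat) =
    3 * card {i. i < p - 1 \<and> (E i)\<^sup>2 = E i}"
proof -
  define w ind :: "'a \<Rightarrow> nat" where "w x = (if x = 0 then 2 else if x = 1 then 1 else 0)"
    and "ind x = (if x = 0 \<or> x = 1 then 1 else 0)" for x
  have plus1: "x + 1 = 0 \<longleftrightarrow> x = 1" "x + 1 = 1 \<longleftrightarrow> x = 0" for x :: 'a
  proof -
    have "x + 1 = 1 + 1 \<longleftrightarrow> x = 1" by (rule add_right_cancel)
    thus "x + 1 = 0 \<longleftrightarrow> x = 1" by (simp only: add_self_char_2[OF char_2])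
  qed simp
  have "2 * (w x + w (x + 1)) = 3 * (ind x + ind (x + 1))" for x
    unfolding w_def ind_def plus1 by (cases "x = 0"; cases "x = 1") simp_all
  hence "2 * (e * (\<Sum>i<f div 2. w (E i) + w (E i + 1))) = 3 * (e * (\<Sum>i<f div 2. ind (E i) + ind (E i + 1)))"
    by (simp add: sum_distrib_left mult.left_commute[of _ e])
  hence "2 * (\<Sum>i<p - 1. w (E i)) = 3 * (\<Sum>i<p - 1. ind (E i))" by (simp only: sum_E_halves)
  moreover have "(\<Sum>i<p - 1. ind (E i)) = card {i. i < p - 1 \<and> (E i)\<^sup>2 = E i}"
  proof -
    have "(\<Sum>i<p - 1. ind (E i)) = card {i \<in> {..<p - 1}. (E i)\<^sup>2 = E i}"
      unfolding ind_def E_in_F2_iff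
      by (simp only: sum.inter_filter[symmetric] finite_lessThan card_eq_sum)
    thus ?thesis by simp
  qed
  ultimately show ?thesis unfolding w_def by (simp only:)
qed

end

text \<open>For \<open>f = 2\<close> and \<open>v = 1\<close> the conditions
  \<open>v = f div 2\<close> and \<open>v = 1\<close> hold together; the guard
  \<open>v \<noteq> f div 2\<close> gives precedence to the former.\<close>

theorem theorem1:
  fixes p e f n g b :: nat
  assumes "prime p" and "odd p" and "p = e * f + 1"
    and "e > 0" and "f > 0" and "even f"
    and "\<not> [2 ^ (p - 1) = 1] (mod p ^ 2)"
    and "n \<ge> 1"
    and "odd g" and "residue_primroot (p ^ n) g"
    and "b < p ^ (n - 1) * f"
  defines "v \<equiv> gcd ((p - 1) div ord p 2) f"
  shows
    "(\<exists>r. r \<le> (p - 1) div ord p 2 \<and>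
          lin_comp (2 * p ^ n) (s_seq p e f n g b) = 2 * p ^ n - r * ord p 2)
     \<and> (v = f div 2 \<longrightarrow> lin_comp (2 * p ^ n) (s_seq p e f n g b) = 2 * p ^ n - p + 1)
     \<and> (v \<noteq> f div 2 \<and> (v = 1 \<or> 2 * v dvd f div 2 \<or> f = v) \<longrightarrow>
          lin_comp (2 * p ^ n) (s_seq p e f n g b) = 2 * p ^ n)
     \<and> (\<exists>r. r \<le> (p - 1) div ord p 2 \<and>
          2 * p ^ n - 2 * r * ord p 2 \<le> lin_comp (2 * p ^ n) (st_seq p e f n g b) \<and>
          lin_comp (2 * p ^ n) (st_seq p e f n g b) \<le> 2 * p ^ n - r * ord p 2)
     \<and> (v = f \<longrightarrow> lin_comp (2 * p ^ n) (st_seq p e f n g b) = 2 * p ^ n - 3 * (p - 1) div 2)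
     \<and> (v dvd f div 2 \<or> (v = 2 \<and> v \<noteq> f) \<longrightarrow>
          lin_comp (2 * p ^ n) (st_seq p e f n g b) = 2 * p ^ n)"
proof -
  interpret gen_cyclotomic p e f n g b by unfold_locales (fact assms)+
  obtain \<gamma> :: "bool mod_ring alg_closure" where \<gamma>: "\<gamma> ^ p = 1" "\<gamma> \<noteq> 1"
    by (rule primitive_root_exists[OF char_bool_mod_ring_alg_closure])
  interpret gen_cyclotomic_root p e f n g b \<gamma>
    by unfold_locales (fact char_bool_mod_ring_alg_closure \<gamma>)+
  obtain a where a: "[g ^ a = 2] (mod p)" "ord p 2 * gcd a (p - 1) = p - 1"
    "gcd ((p - 1) div ord p 2) f = gcd a f" "(p - 1) div ord p 2 = gcd a (p - 1)"
    "ord p 2 > 0"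
    by (rule index_of_2)
  have v: "v = gcd a f" unfolding v_def by (rule a(3))
  define F4 where "F4 = {i. i < p - 1 \<and> (E i)\<^sup>2 + E i + 1 = 0}"
  define F2 where "F2 = {i. i < p - 1 \<and> (E i)\<^sup>2 = E i}"
  define W where "W = (\<Sum>i<p - 1. if E i = 0 then 2 else if E i = 1 then 1 else 0 :: nat)"
  have Ls: "lin_comp (2 * p ^ n) (s_seq p e f n g b) = 2 * p ^ n - card F4"
    unfolding F4_def by (rule lin_comp_s) unfold_locales
  have Lst: "lin_comp (2 * p ^ n) (st_seq p e f n g b) = 2 * p ^ n - W"
    unfolding W_def by (rule lin_comp_st) unfold_locales
  have W: "2 * W = 3 * card F2" unfolding W_def F2_def by (rule sum_weights_F2)
  have "(x\<^sup>2)\<^sup>2 + x\<^sup>2 + 1 = 0" if F4: "x\<^sup>2 + x + 1 = 0" for x :: "bool mod_ring alg_closure"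
  proof -
    have "(x\<^sup>2)\<^sup>2 + x\<^sup>2 + 1 = x\<^sup>2 + x + 1"
      unfolding F4_element_square(2)[OF char_2 F4] by (simp only: add_ac)
    thus ?thesis unfolding F4 .
  qed
  then obtain r where r: "r \<le> gcd a (p - 1)" "card F4 = r * ord p 2"
    unfolding F4_def by (rule card_E_multiple_of_ord[where Q = "\<lambda>x. x\<^sup>2 + x + 1 = 0", OF a(1,2)])
  have "(x\<^sup>2)\<^sup>2 = x\<^sup>2" if "x\<^sup>2 = x" for x :: "bool mod_ring alg_closure"
    by (simp only: that)
  then obtain r' where r': "r' \<le> gcd a (p - 1)" "card F2 = r' * ord p 2"
    unfolding F2_def by (rule card_E_multiple_of_ord[where Q = "\<lambda>x. x\<^sup>2 = x", OF a(1,2)])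
  \<comment> \<open>This keeps the truncated subtraction in \<open>2 * p ^ n - p + 1\<close>
    faithful.\<close>
  have p_le: "p \<le> p ^ n" using n_pos p_gt_2 by (intro self_le_power) simp_all
  show ?thesis
  proof (intro conjI impI)
    show "\<exists>r. r \<le> (p - 1) div ord p 2 \<and>
        lin_comp (2 * p ^ n) (s_seq p e f n g b) = 2 * p ^ n - r * ord p 2"
      using r unfolding Ls a(4) by (intro exI[of _ r] conjI) simp_all
  next
    assume "v = f div 2"
    hence "F4 = {..<p - 1}" unfolding F4_def using all_E_in_F4[OF a(1)] v by auto
    hence "card F4 = p - 1" by simp
    thus "lin_comp (2 * p ^ n) (s_seq p e f n g b) = 2 * p ^ n - p + 1"
      unfolding Ls using p_le p_gt_2 by simp
  next
    assume "v \<noteq> f div 2 \<and> (v = 1 \<or> 2 * v dvd f div 2 \<or> f = v)"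
    hence "F4 = {}" unfolding F4_def using no_E_in_F4[OF a(1) v] by blast
    thus "lin_comp (2 * p ^ n) (s_seq p e f n g b) = 2 * p ^ n" unfolding Ls by simp
  next
    \<comment> \<open>\<open>W\<close> is one and a half times the count, so the same
      \<open>r'\<close> serves both bounds.\<close>
    have "card F2 \<le> W" "W \<le> 2 * card F2" using W by simp_all
    thus "\<exists>r. r \<le> (p - 1) div ord p 2 \<and>
          2 * p ^ n - 2 * r * ord p 2 \<le> lin_comp (2 * p ^ n) (st_seq p e f n g b) \<and>
          lin_comp (2 * p ^ n) (st_seq p e f n g b) \<le> 2 * p ^ n - r * ord p 2"
      using r' unfolding Lst a(4) by (intro exI[of _ r'] conjI) (simp_all add: diff_le_mono2)
  next
    assume "v = f"
    hence "F2 = {..<p - 1}" unfolding F2_def using all_E_in_F2[OF a(1)] v by auto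
    hence "2 * W = 3 * (p - 1)" using W by simp
    thus "lin_comp (2 * p ^ n) (st_seq p e f n g b) = 2 * p ^ n - 3 * (p - 1) div 2"
      unfolding Lst by simp
  next
    assume "v dvd f div 2 \<or> (v = 2 \<and> v \<noteq> f)"
    hence "F2 = {}" unfolding F2_def using no_E_in_F2[OF a(1) v] by blast
    hence "W = 0" using W by simp
    thus "lin_comp (2 * p ^ n) (st_seq p e f n g b) = 2 * p ^ n" unfolding Lst by simp
  qed
qed

end
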